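(* Let $m=2,3,\ldots,\infty$, and let $$f(\lambda_1,\ldots,\lambda_n):=\sum_{\mathbf{p}\in\mathbb{Z}_+^n,|\mathbf{p}|\leq m-1}\lambda^{\mathbf{p}}a_{\mathbf{p}},\quad a_{\mathbf{p}}\in\mathbb{C},$$ be an analytic function in $H^\infty_{\mathrm{sym}}(\mathbb{B}_n)$. Then $$\sum_{k=0}^{m-1}\left|\sum_{\mathbf{p}\in\mathbb{Z}_+^n,|\mathbf{p}|=k}\lambda^{\mathbf{p}}|a_{\mathbf{p}}|\right|\leq\|f\|_{\mathrm{sym}}$$ for any $\lambda:=(\lambda_1,\ldots,\lambda_n)\in\mathbb{B}_n$ with $\|\lambda\|_2\leq t_m$, where, if $m<\infty$, $t_m\in(0,1]$ is the solution of the equation $$\sum_{k=1}^{m-1}t^k\cos\frac{\pi}{\left[\frac{m-1}{k}\right]+2}=\frac12$$ ($[x]$ denoting the integer part of $x$), and $t_\infty=\frac13$.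
   Context: $\mathbb{B}_n$ is the open unit ball of $\mathbb{C}^n$, $\|\cdot\|_2$ the Euclidean norm. For $\mathbf{p}=(p_1,\dots,p_n)\in\mathbb{Z}_+^n$: $|\mathbf{p}|:=p_1+\cdots+p_n$, $\mathbf{p}!:=p_1!\cdots p_n!$, $\lambda^{\mathbf{p}}:=\lambda_1^{p_1}\cdots\lambda_n^{p_n}$. When $m=\infty$, sums with upper bound $m-1$ run over all indices. $H_n$ is an $n$-dimensional complex Hilbert space with orthonormal basis $e_1,\dots,e_n$; $F^2(H_n)=\bigoplus_{k\ge0}H_n^{\otimes k}$ (with $H_n^{\otimes0}=\mathbb{C}1$) is the full Fock space and $S_i\varphi=e_i\otimes\varphi$ the left creation operators. $\mathbb{F}_n^+$ is the unital free semigroup on $g_1,\dots,g_n$ with identity $g_0$; for $\alpha=g_{i_1}\cdots g_{i_k}$, $S_\alpha:=S_{i_1}\cdots S_{i_k}$, $\lambda_\alpha:=\lambda_{i_1}\cdots\lambda_{i_k}$ ($S_{g_0}=I$, $\lambda_{g_0}=1$). Let $\Lambda_{\mathbf{p}}:=\{\alpha\in\mathbb{F}_n^+:\lambda_\alpha=\lambda^{\mathbf{p}}\text{ for all }\lambda\in\mathbb{B}_n\}$ and $(\lambda^{\mathbf{p}})_{\mathrm{sym}}(S_1,\ldots,S_n):=\frac{\mathbf{p}!}{|\mathbf{p}|!}\sum_{\alpha\in\Lambda_{\mathbf{p}}}S_\alpha$. $H^\infty_{\mathrm{sym}}(\mathbb{B}_n)$ is the set of all analytic functions $f(\lambda)=\sum_{\mathbf{p}\in\mathbb{Z}_+^n}\lambda^{\mathbf{p}}a_{\mathbf{p}}$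 on $\mathbb{B}_n$, $a_{\mathbf{p}}\in\mathbb{C}$, such that $\limsup_{k\to\infty}\left(\sum_{|\mathbf{p}|=k}\frac{|\mathbf{p}|!}{\mathbf{p}!}|a_{\mathbf{p}}|^2\right)^{1/2k}\leq1$ and $\|f\|_{\mathrm{sym}}:=\sup_{0\leq r<1}\|f_{\mathrm{sym}}(rS_1,\ldots,rS_n)\|<\infty$, where $f_{\mathrm{sym}}(rS_1,\ldots,rS_n):=\sum_{k=0}^\infty\sum_{|\mathbf{p}|=k}r^ka_{\mathbf{p}}(\lambda^{\mathbf{p}})_{\mathrm{sym}}(S_1,\ldots,S_n)$ (norm convergent in $k$ for $0\le r<1$). *)

theory Defs
  imports "HOL-Analysis.Analysis"
begin

section \<open>The full Fock space\<close>

text \<open>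
  The index set of the basis \<open>e\<^sub>1, \<dots>, e\<^sub>n\<close> is a finite type \<open>'n\<close>, and \<open>H\<^sub>n\<close> is \<open>complex ^ 'n\<close>.
  The free semigroup \<open>\<F>\<^sub>n\<^sup>+\<close> is \<open>'n list\<close> (concatenation, with \<open>[]\<close> as \<open>g\<^sub>0\<close>).  A vector of
  \<open>F\<^sup>2(H\<^sub>n)\<close> is given by its square-summable coordinates with respect to the orthonormal basis
  \<open>e\<^bsub>i1\<^esub> \<otimes> \<dots> \<otimes> e\<^bsub>ik\<^esub>\<close>, indexed by the word \<open>[i1, \<dots>, ik]\<close>; the words of length \<open>k\<close> give the
  coordinates of the summand \<open>H\<^sub>n\<^sup>\<otimes>\<^sup>k\<close>.
\<close>

typedef 'n fock = "{\<phi> :: 'n list \<Rightarrow> complex. (\<lambda>w. (cmod (\<phi> w))\<^sup>2) summable_on UNIV}"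
  morphisms coord Fock
proof
  show "(\<lambda>_. 0) \<in> {\<phi> :: 'n list \<Rightarrow> complex. (\<lambda>w. (cmod (\<phi> w))\<^sup>2) summable_on UNIV}" by simp
qed

setup_lifting type_definition_fock

lemma coord_summable: "(\<lambda>w. (cmod (coord \<phi> w))\<^sup>2) summable_on UNIV"
  using coord[of \<phi>] by simp

lemma l2_add:
  fixes f g :: "'a \<Rightarrow> complex"
  assumes "(\<lambda>w. (cmod (f w))\<^sup>2) summable_on A" and "(\<lambda>w. (cmod (g w))\<^sup>2) summable_on A"
  shows "(\<lambda>w. (cmod (f w + g w))\<^sup>2) summable_on A"
proof (rule summable_on_comparison_test)
  show "(\<lambda>w. 2 * (cmod (f w))\<^sup>2 + 2 * (cmod (g w))\<^sup>2) summable_on A"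
    using assms by (intro summable_on_add summable_on_cmult_right)
  fix w
  have "(cmod (f w + g w))\<^sup>2 \<le> (cmod (f w) + cmod (g w))\<^sup>2"
    by (intro power_mono norm_triangle_ineq) auto
  also have "\<dots> \<le> 2 * (cmod (f w))\<^sup>2 + 2 * (cmod (g w))\<^sup>2"
    using zero_le_power2[of "cmod (f w) - cmod (g w)"] by (simp add: power2_eq_square algebra_simps)
  finally show "(cmod (f w + g w))\<^sup>2 \<le> 2 * (cmod (f w))\<^sup>2 + 2 * (cmod (g w))\<^sup>2" .
qed simp

lemma l2_cmult:
  fixes f :: "'a \<Rightarrow> complex"
  assumes "(\<lambda>w. (cmod (f w))\<^sup>2) summable_on A"
  shows "(\<lambda>w. (cmod (c * f w))\<^sup>2) summable_on A"
  using summable_on_cmult_right[OF assms, of "(cmod c)\<^sup>2"] by (simp add: norm_mult power_mult_distrib)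

lemma l2_inner:
  fixes f g :: "'a \<Rightarrow> complex"
  assumes "(\<lambda>w. (cmod (f w))\<^sup>2) summable_on A" and "(\<lambda>w. (cmod (g w))\<^sup>2) summable_on A"
  shows "(\<lambda>w. f w \<bullet> g w) summable_on A"
proof -
  have "(\<lambda>w. - ((cmod (f w))\<^sup>2 + (cmod (g w))\<^sup>2)) summable_on A"
    unfolding summable_on_uminus by (intro summable_on_add assms)
  then have s: "(\<lambda>w. (cmod (f w + g w))\<^sup>2 + (- ((cmod (f w))\<^sup>2 + (cmod (g w))\<^sup>2))) summable_on A"
    by (intro summable_on_add l2_add assms)
  have "f w \<bullet> g w = (1/2) * ((cmod (f w + g w))\<^sup>2 + (- ((cmod (f w))\<^sup>2 + (cmod (g w))\<^sup>2)))" for w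
    by (simp add: power2_norm_eq_inner inner_add_left inner_add_right inner_commute)
  then show ?thesis using summable_on_cmult_right[OF s, of "1/2"] by presburger
qed

instantiation fock :: (type) real_vector
begin

lift_definition zero_fock :: "'a fock" is "\<lambda>_. 0" by simp

lift_definition plus_fock :: "'a fock \<Rightarrow> 'a fock \<Rightarrow> 'a fock" is "\<lambda>\<phi> \<psi> w. \<phi> w + \<psi> w"
  by (simp add: l2_add)

lift_definition uminus_fock :: "'a fock \<Rightarrow> 'a fock" is "\<lambda>\<phi> w. - \<phi> w" by simp

lift_definition minus_fock :: "'a fock \<Rightarrow> 'a fock \<Rightarrow> 'a fock" is "\<lambda>\<phi> \<psi> w. \<phi> w - \<psi> w"
proof -
  fix f g :: "'a list \<Rightarrow> complex"
  assume "(\<lambda>w. (cmod (f w))\<^sup>2) summable_on UNIV" and "(\<lambda>w. (cmod (g w))\<^sup>2) summable_on UNIV"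
  then show "(\<lambda>w. (cmod (f w - g w))\<^sup>2) summable_on UNIV"
    using l2_add[of f UNIV "\<lambda>w. - g w"] by simp
qed

lift_definition scaleR_fock :: "real \<Rightarrow> 'a fock \<Rightarrow> 'a fock" is "\<lambda>c \<phi> w. c *\<^sub>R \<phi> w"
  using l2_cmult by (auto simp: scaleR_conv_of_real)

instance
  by standard (transfer; auto simp: algebra_simps)+

end

instantiation fock :: (type) real_inner
begin

lift_definition inner_fock :: "'a fock \<Rightarrow> 'a fock \<Rightarrow> real" is "\<lambda>\<phi> \<psi>. \<Sum>\<^sub>\<infinity>w. \<phi> w \<bullet> \<psi> w" .

definition norm_fock :: "'a fock \<Rightarrow> real" where
  "norm_fock \<phi> = sqrt (\<phi> \<bullet> \<phi>)"

definition dist_fock :: "'a fock \<Rightarrow> 'a fock \<Rightarrow> real" where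
  "dist_fock \<phi> \<psi> = norm (\<phi> - \<psi>)"

definition sgn_fock :: "'a fock \<Rightarrow> 'a fock" where
  "sgn_fock \<phi> = \<phi> /\<^sub>R norm \<phi>"

definition uniformity_fock :: "('a fock \<times> 'a fock) filter" where
  "uniformity_fock = (INF e\<in>{0<..}. principal {(\<phi>, \<psi>). dist \<phi> \<psi> < e})"

definition open_fock :: "'a fock set \<Rightarrow> bool" where
  "open_fock U \<longleftrightarrow> (\<forall>\<phi>\<in>U. \<forall>\<^sub>F (\<phi>', \<psi>) in uniformity. \<phi>' = \<phi> \<longrightarrow> \<psi> \<in> U)"

instance
proof
  fix x y z :: "'a fock" and r :: real
  show "dist x y = norm (x - y)" by (rule dist_fock_def)
  show "sgn x = x /\<^sub>R norm x" by (rule sgn_fock_def)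
  show "(uniformity :: ('a fock \<times> 'a fock) filter) = (INF e\<in>{0<..}. principal {(x, y). dist x y < e})"
    by (rule uniformity_fock_def)
  show "open U \<longleftrightarrow> (\<forall>x\<in>U. \<forall>\<^sub>F (x', y) in uniformity. x' = x \<longrightarrow> y \<in> U)" for U :: "'a fock set"
    by (rule open_fock_def)
  show "norm x = sqrt (x \<bullet> x)" by (rule norm_fock_def)
  show "x \<bullet> y = y \<bullet> x" by transfer (simp add: inner_commute)
  show "(x + y) \<bullet> z = x \<bullet> z + y \<bullet> z"
    by transfer (simp add: inner_add_left infsum_add l2_inner)
  show "(r *\<^sub>R x) \<bullet> y = r * (x \<bullet> y)"
    by transfer (simp add: infsum_cmult_right')
  show "0 \<le> x \<bullet> x" by transfer (simp add: infsum_nonneg)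
  show "x \<bullet> x = 0 \<longleftrightarrow> x = 0"
  proof
    assume "x \<bullet> x = 0"
    then show "x = 0"
    proof transfer
      fix f :: "'a list \<Rightarrow> complex"
      assume f: "(\<lambda>w. (cmod (f w))\<^sup>2) summable_on UNIV" and z: "(\<Sum>\<^sub>\<infinity>w. f w \<bullet> f w) = 0"
      have "f w \<bullet> f w = 0" for w
        by (rule nonneg_infsum_le_0D[of "\<lambda>w. f w \<bullet> f w" UNIV]) (use f z l2_inner[of f UNIV f] in auto)
      then show "f = (\<lambda>_. 0)" by auto
    qed
  next
    assume "x = 0"
    then show "x \<bullet> x = 0" by simp (transfer, simp)
  qed
qed

end

lemma norm_fock_sq: "(norm \<phi>)\<^sup>2 = (\<Sum>\<^sub>\<infinity>w. (cmod (coord \<phi> w))\<^sup>2)"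
  unfolding power2_norm_eq_inner by transfer simp

lemma coord_le_norm: "cmod (coord \<phi> w) \<le> norm \<phi>"
proof -
  have "(\<Sum>v\<in>{w}. (cmod (coord \<phi> v))\<^sup>2) \<le> (\<Sum>\<^sub>\<infinity>v. (cmod (coord \<phi> v))\<^sup>2)"
    by (rule finite_sum_le_infsum) (auto simp: coord_summable)
  then show ?thesis by (simp add: norm_fock_sq[symmetric] power2_le_iff_abs_le)
qed

instance fock :: (type) banach
proof
  fix X :: "nat \<Rightarrow> 'a fock"
  assume X: "Cauchy X"
  have sub: "coord (\<phi> - \<psi>) w = coord \<phi> w - coord \<psi> w" for \<phi> \<psi> :: "'a fock" and w
    by transfer simp
  have "Cauchy (\<lambda>n. coord (X n) w)" for w
  proof (rule CauchyI)
    fix e :: real assume "e > 0"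
    then obtain M where M: "\<forall>m\<ge>M. \<forall>n\<ge>M. norm (X m - X n) < e" using CauchyD[OF X] by blast
    then have "cmod (coord (X m) w - coord (X n) w) < e" if "m \<ge> M" "n \<ge> M" for m n
      using coord_le_norm[of "X m - X n" w] that unfolding sub by force
    then show "\<exists>M. \<forall>m\<ge>M. \<forall>n\<ge>M. cmod (coord (X m) w - coord (X n) w) < e" by blast
  qed
  then have "\<exists>L. \<forall>w. (\<lambda>n. coord (X n) w) \<longlonglongrightarrow> L w"
    by (intro choice) (auto simp: Cauchy_convergent_iff convergent_def)
  then obtain L where L: "\<And>w. (\<lambda>n. coord (X n) w) \<longlonglongrightarrow> L w" by blast
  have bd: "(\<Sum>w\<in>F. (cmod (coord (X m) w - L w))\<^sup>2) \<le> e\<^sup>2"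
    if "finite F" "\<forall>n\<ge>M. norm (X m - X n) < e" for F m M e
  proof (rule tendsto_upperbound)
    show "(\<lambda>n. \<Sum>w\<in>F. (cmod (coord (X m) w - coord (X n) w))\<^sup>2)
        \<longlonglongrightarrow> (\<Sum>w\<in>F. (cmod (coord (X m) w - L w))\<^sup>2)"
      by (intro tendsto_intros L)
    have "(\<Sum>w\<in>F. (cmod (coord (X m) w - coord (X n) w))\<^sup>2) \<le> e\<^sup>2" if "n \<ge> M" for n
    proof -
      have "(\<Sum>w\<in>F. (cmod (coord (X m - X n) w))\<^sup>2) \<le> (norm (X m - X n))\<^sup>2"
        unfolding norm_fock_sq by (rule finite_sum_le_infsum) (auto simp: coord_summable \<open>finite F\<close>)
      also have "\<dots> \<le> e\<^sup>2"
        using \<open>\<forall>n\<ge>M. norm (X m - X n) < e\<close> that by (intro power_mono) (auto intro: less_imp_le)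
      finally show ?thesis by (simp add: sub)
    qed
    then show "\<forall>\<^sub>F n in sequentially. (\<Sum>w\<in>F. (cmod (coord (X m) w - coord (X n) w))\<^sup>2) \<le> e\<^sup>2"
      by (auto simp: eventually_sequentially)
  qed simp
  have sm: "(\<lambda>w. (cmod (coord (X m) w - L w))\<^sup>2) summable_on UNIV"
    if "\<forall>n\<ge>M. norm (X m - X n) < e" for m M e
    by (rule nonneg_bdd_above_summable_on) (use bd that in \<open>auto intro!: bdd_aboveI\<close>)
  obtain M1 where "\<forall>m\<ge>M1. \<forall>n\<ge>M1. norm (X m - X n) < 1" using CauchyD[OF X, of 1] by auto
  then have "(\<lambda>w. (cmod (coord (X M1) w - L w))\<^sup>2) summable_on UNIV" using sm[of M1 M1 1] by simp
  then have "(\<lambda>w. (cmod (coord (X M1) w + - (coord (X M1) w - L w)))\<^sup>2) summable_on UNIV"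
    by (intro l2_add coord_summable) (simp only: norm_minus_cancel)
  then have Ls: "(\<lambda>w. (cmod (L w))\<^sup>2) summable_on UNIV" by simp
  have cL: "coord (Fock L) = L" using Ls by (simp add: Fock_inverse)
  have "X \<longlonglongrightarrow> Fock L"
  proof (rule LIMSEQ_I)
    fix e :: real assume e: "e > 0"
    then obtain M where M: "\<forall>m\<ge>M. \<forall>n\<ge>M. norm (X m - X n) < e / 2" using CauchyD[OF X, of "e/2"] by auto
    have "norm (X m - Fock L) < e" if "m \<ge> M" for m
    proof -
      have "(norm (X m - Fock L))\<^sup>2 \<le> (e / 2)\<^sup>2"
        unfolding norm_fock_sq sub cL
        by (rule infsum_le_finite_sums[OF sm[of M m "e/2"]]) (use M that bd[of _ M m "e/2"] in auto)
      then have "norm (X m - Fock L) \<le> e / 2" using e by (simp add: power2_le_iff_abs_le)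
      then show ?thesis using e by simp
    qed
    then show "\<exists>M. \<forall>m\<ge>M. norm (X m - Fock L) < e" by blast
  qed
  then show "convergent X" by (rule convergentI)
qed

section \<open>Creation operators\<close>

lemma tensor_left_has_sum:
  fixes x :: "complex ^ 'n" and f :: "'n list \<Rightarrow> complex"
  assumes "(\<lambda>w. (cmod (f w))\<^sup>2) summable_on UNIV"
  shows "((\<lambda>w. (cmod (case w of [] \<Rightarrow> 0 | i # v \<Rightarrow> x $ i * f v))\<^sup>2) has_sum
    (norm x)\<^sup>2 * (\<Sum>\<^sub>\<infinity>w. (cmod (f w))\<^sup>2)) UNIV"
proof -
  let ?g = "\<lambda>w. (cmod (case w of [] \<Rightarrow> 0 | i # v \<Rightarrow> x $ i * f v))\<^sup>2"
  let ?S = "\<Sum>\<^sub>\<infinity>w. (cmod (f w))\<^sup>2"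
  have 1: "(?g has_sum ((cmod (x $ i))\<^sup>2 * ?S)) (range (Cons i))" for i
  proof -
    have "((\<lambda>v. (cmod (x $ i))\<^sup>2 * (cmod (f v))\<^sup>2) has_sum ((cmod (x $ i))\<^sup>2 * ?S)) UNIV"
      by (intro has_sum_cmult_right has_sum_infsum assms)
    then show ?thesis
      by (subst has_sum_reindex) (auto simp: o_def norm_mult power_mult_distrib)
  qed
  have "(?g has_sum (\<Sum>i\<in>UNIV. (cmod (x $ i))\<^sup>2 * ?S)) (\<Union>i\<in>UNIV. range (Cons i))"
    by (rule sum_has_sum) (use 1 in auto)
  moreover have "(\<Sum>i\<in>UNIV. (cmod (x $ i))\<^sup>2 * ?S) = (norm x)\<^sup>2 * ?S"
    by (simp add: norm_vec_def L2_set_def sum_nonneg sum_distrib_right)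
  ultimately have "(?g has_sum ((norm x)\<^sup>2 * ?S)) (\<Union>i\<in>UNIV. range (Cons i))" by simp
  moreover have "(?g has_sum ((norm x)\<^sup>2 * ?S)) (\<Union>i\<in>UNIV. range (Cons i)) \<longleftrightarrow>
    (?g has_sum ((norm x)\<^sup>2 * ?S)) UNIV"
  proof (rule has_sum_cong_neutral)
    fix w :: "'n list"
    assume "w \<in> UNIV - (\<Union>i\<in>UNIV. range (Cons i))"
    then show "?g w = 0" by (cases w) auto
  qed auto
  ultimately show ?thesis by simp
qed

text \<open>The map \<open>\<phi> \<mapsto> x \<otimes> \<phi>\<close> for \<open>x \<in> H\<^sub>n\<close>, in coordinates.\<close>

lift_definition tensor_left :: "complex ^ 'n \<Rightarrow> 'n fock \<Rightarrow> 'n fock" is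
  "\<lambda>x \<phi> w. case w of [] \<Rightarrow> 0 | i # v \<Rightarrow> x $ i * \<phi> v"
  by (rule has_sum_imp_summable[OF tensor_left_has_sum])

lemma norm_tensor_left: "norm (tensor_left x \<phi>) = norm x * norm \<phi>"
proof -
  have "(norm (tensor_left x \<phi>))\<^sup>2 = (norm x * norm \<phi>)\<^sup>2"
    unfolding power_mult_distrib norm_fock_sq tensor_left.rep_eq
    by (rule infsumI[OF tensor_left_has_sum[OF coord_summable]])
  then show ?thesis by (simp add: power2_eq_iff_nonneg)
qed

lemma bounded_linear_tensor_left: "bounded_linear (tensor_left x)"
proof (rule bounded_linear_intro[where K = "norm x"])
  show "tensor_left x (\<phi> + \<psi>) = tensor_left x \<phi> + tensor_left x \<psi>" for \<phi> \<psi>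
    by transfer (auto split: list.split simp: algebra_simps)
  show "tensor_left x (r *\<^sub>R \<phi>) = r *\<^sub>R tensor_left x \<phi>" for r \<phi>
    by transfer (auto split: list.split)
  show "norm (tensor_left x \<phi>) \<le> norm \<phi> * norm x" for \<phi>
    by (simp add: norm_tensor_left)
qed

lift_definition fock_scaleC :: "complex \<Rightarrow> 'n fock \<Rightarrow> 'n fock" is "\<lambda>c \<phi> w. c * \<phi> w"
  by (simp add: l2_cmult)

lemma bounded_linear_fock_scaleC: "bounded_linear (fock_scaleC c)"
proof (rule bounded_linear_intro[where K = "cmod c"])
  show "fock_scaleC c (\<phi> + \<psi>) = fock_scaleC c \<phi> + fock_scaleC c \<psi>" for \<phi> \<psi> :: "'n fock"
    by transfer (simp add: algebra_simps)
  show "fock_scaleC c (r *\<^sub>R \<phi>) = r *\<^sub>R fock_scaleC c \<phi>" for r and \<phi> :: "'n fock"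
    by transfer simp
  show "norm (fock_scaleC c \<phi>) \<le> norm \<phi> * cmod c" for \<phi> :: "'n fock"
  proof -
    have "(norm (fock_scaleC c \<phi>))\<^sup>2 = (norm \<phi> * cmod c)\<^sup>2"
      unfolding power_mult_distrib norm_fock_sq fock_scaleC.rep_eq
      by (simp add: norm_mult power_mult_distrib infsum_cmult_right' mult.commute)
    then show ?thesis by (simp add: power2_eq_iff_nonneg)
  qed
qed

text \<open>
  Operators are elements of the Banach space of bounded real-linear maps; the operators below are
  complex-linear, and the norm of such a map does not depend on the scalar field.
\<close>

definition creation :: "'n \<Rightarrow> 'n::finite fock \<Rightarrow>\<^sub>L 'n fock" where
  "creation i = Blinfun (tensor_left (axis i 1))"

primrec creation_word :: "'n list \<Rightarrow> 'n::finite fock \<Rightarrow>\<^sub>L 'n fock" where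
  "creation_word [] = id_blinfun"
| "creation_word (i # \<alpha>) = creation i o\<^sub>L creation_word \<alpha>"

definition op_scaleC :: "complex \<Rightarrow> ('n fock \<Rightarrow>\<^sub>L 'n fock) \<Rightarrow> 'n fock \<Rightarrow>\<^sub>L 'n fock" where
  "op_scaleC c T = Blinfun (fock_scaleC c) o\<^sub>L T"

lemma creation_apply: "blinfun_apply (creation i) = tensor_left (axis i 1)"
  unfolding creation_def by (rule bounded_linear_Blinfun_apply[OF bounded_linear_tensor_left])

lemma op_scaleC_apply: "blinfun_apply (op_scaleC c T) \<phi> = fock_scaleC c (blinfun_apply T \<phi>)"
  by (simp add: op_scaleC_def bounded_linear_Blinfun_apply[OF bounded_linear_fock_scaleC])

section \<open>Multi-indices and symmetrized monomials\<close>

definition mi_deg :: "('n::finite \<Rightarrow> nat) \<Rightarrow> nat" where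
  "mi_deg p = (\<Sum>i\<in>UNIV. p i)"

definition mi_fact :: "('n::finite \<Rightarrow> nat) \<Rightarrow> nat" where
  "mi_fact p = (\<Prod>i\<in>UNIV. fact (p i))"

definition mi_power :: "complex ^ 'n \<Rightarrow> ('n \<Rightarrow> nat) \<Rightarrow> complex" where
  "mi_power z p = (\<Prod>i\<in>UNIV. (z $ i) ^ p i)"

definition word_power :: "complex ^ 'n \<Rightarrow> 'n list \<Rightarrow> complex" where
  "word_power z \<alpha> = prod_list (map (\<lambda>i. z $ i) \<alpha>)"

definition mi_words :: "('n::finite \<Rightarrow> nat) \<Rightarrow> 'n list set" where
  "mi_words p = {\<alpha>. \<forall>z\<in>ball 0 1. word_power z \<alpha> = mi_power z p}"

definition sym_monomial :: "('n::finite \<Rightarrow> nat) \<Rightarrow> 'n fock \<Rightarrow>\<^sub>L 'n fock" where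
  "sym_monomial p = (real (mi_fact p) / fact (mi_deg p)) *\<^sub>R (\<Sum>\<alpha>\<in>mi_words p. creation_word \<alpha>)"

lemma finite_mi_deg: "finite {p :: 'n::finite \<Rightarrow> nat. mi_deg p = k}"
proof (rule finite_subset)
  show "{p :: 'n \<Rightarrow> nat. mi_deg p = k} \<subseteq> PiE UNIV (\<lambda>_. {..k})"
    by (auto simp: mi_deg_def intro: member_le_sum)
qed (intro finite_PiE; simp)

lemma finite_mi_words: "finite (mi_words p)"
proof (rule finite_subset)
  define c where "c = 1 / (2 * real CARD('a))"
  have "1 \<le> real CARD('a)" by (simp add: Suc_le_eq)
  then have "1 < 2 * real CARD('a)" by linarith
  then have c: "0 < c" "c < 1" by (auto simp: c_def divide_simps)
  define z :: "complex ^ 'a" where "z = (\<chi> i. of_real c)"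
  have "norm z \<le> (\<Sum>i\<in>UNIV. norm (z $ i))" by (simp add: norm_vec_def L2_set_le_sum)
  also have "\<dots> = 1 / 2" using c(1) by (simp add: z_def) (simp add: c_def)
  finally have z: "z \<in> ball 0 1" by simp
  have len: "length \<alpha> = mi_deg p" if "\<alpha> \<in> mi_words p" for \<alpha>
  proof -
    have w: "word_power z \<alpha> = of_real (c ^ length \<alpha>)"
      by (induction \<alpha>) (auto simp: word_power_def z_def)
    have m: "mi_power z p = of_real (c ^ mi_deg p)"
      by (simp add: mi_power_def mi_deg_def z_def power_sum)
    have "word_power z \<alpha> = mi_power z p" using that z by (auto simp: mi_words_def)
    then have "c ^ length \<alpha> = c ^ mi_deg p" unfolding w m of_real_eq_iff .
    then show ?thesis using c power_inject_exp'[of c "length \<alpha>" "mi_deg p"] by simp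
  qed
  show "mi_words p \<subseteq> {\<alpha>. set \<alpha> \<subseteq> UNIV \<and> length \<alpha> = mi_deg p}" using len by auto
  show "finite {\<alpha> :: 'a list. set \<alpha> \<subseteq> UNIV \<and> length \<alpha> = mi_deg p}"
    by (rule finite_lists_length_eq) simp
qed

section \<open>The algebra of symmetrizable bounded functions\<close>

text \<open>
  Elements of \<open>H\<^sup>\<infinity>\<^sub>s\<^sub>y\<^sub>m(\<B>\<^sub>n)\<close> are represented by functions on the whole space; only their values on
  the open unit ball matter.  A power series that converges on the ball does so absolutely, so that
  the unordered sum is no restriction.
\<close>

definition ball_series :: "(complex ^ 'n \<Rightarrow> complex) \<Rightarrow> (('n \<Rightarrow> nat) \<Rightarrow> complex) \<Rightarrow> bool" where
  "ball_series f a \<longleftrightarrow> (\<forall>z\<in>ball 0 1. ((\<lambda>p. mi_power z p * a p) has_sum f z) UNIV)"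

definition ball_coeffs :: "(complex ^ 'n \<Rightarrow> complex) \<Rightarrow> ('n \<Rightarrow> nat) \<Rightarrow> complex" where
  "ball_coeffs f = (THE a. ball_series f a)"

lemma homogeneous_zero:
  fixes d :: "('n::finite \<Rightarrow> nat) \<Rightarrow> complex"
  assumes "\<And>z. z \<in> ball 0 1 \<Longrightarrow> (\<Sum>p | mi_deg p = k. mi_power z p * d p) = 0" and q: "mi_deg q = k"
  shows "d q = 0"
proof -
  define N where "N = Suc k"
  define \<zeta> where "\<zeta> = cis (2 * pi / real N)"
  define c where "c = 1 / (2 * real CARD('n))"
  have c: "c > 0" by (simp add: c_def)
  define J where "J = PiE (UNIV :: 'n set) (\<lambda>_. {..<N})"
  define z :: "('n \<Rightarrow> nat) \<Rightarrow> complex ^ 'n" where "z j = (\<chi> i. of_real c * \<zeta> ^ j i)" for j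
  have nz: "\<zeta> \<noteq> 0" "norm \<zeta> = 1" by (auto simp: \<zeta>_def)
  have zb: "z j \<in> ball 0 1" for j
  proof -
    have "norm (z j) \<le> (\<Sum>i\<in>UNIV. norm (z j $ i))" by (simp add: norm_vec_def L2_set_le_sum)
    also have "\<dots> = 1 / 2" using c nz by (simp add: z_def norm_mult norm_power) (simp add: c_def)
    finally show ?thesis by simp
  qed
  have le: "p i \<le> k" if "mi_deg p = k" for p and i :: 'n
    using that member_le_sum[of i UNIV p] by (simp add: mi_deg_def)
  have geo: "(\<Sum>j<N. (\<zeta> ^ a / \<zeta> ^ b) ^ j) = (if a = b then of_nat N else 0)" if "a \<le> k" "b \<le> k" for a b
  proof (cases "a = b")
    case False
    have \<zeta>p: "\<zeta> ^ a / \<zeta> ^ b = cis (2 * pi * (real a - real b) / real N)"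
    proof -
      have "real a * (2 * pi / real N) - real b * (2 * pi / real N) = 2 * pi * (real a - real b) / real N"
        by (simp add: algebra_simps diff_divide_distrib)
      then show ?thesis unfolding \<zeta>_def Complex.DeMoivre cis_divide by (rule arg_cong)
    qed
    have "\<zeta> ^ a / \<zeta> ^ b \<noteq> 1"
    proof
      assume "\<zeta> ^ a / \<zeta> ^ b = 1"
      then have "cis (2 * pi * (real a - real b) / real N) = 1" unfolding \<zeta>p .
      then have "cos (2 * pi * (real a - real b) / real N) = 1" by (simp add: complex_eq_iff)
      then obtain m :: int where "2 * pi * (real a - real b) / real N = of_int m * 2 * pi"
        using cos_one_2pi_int by blast
      then have "2 * pi * (real a - real b) = of_int m * 2 * pi * real N"
        by (simp add: divide_eq_eq N_def del: of_nat_Suc)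
      then have "(2 * pi) * (real a - real b) = (2 * pi) * (of_int m * real N)" by (simp only: mult_ac)
      then have "real a - real b = of_int m * real N" by simp
      then have "of_int (int a - int b) = (of_int (m * int N) :: real)" by simp
      then have eq: "int a - int b = m * int N" unfolding of_int_eq_iff .
      then have "m \<noteq> 0" using False by auto
      then have "int N \<le> \<bar>m * int N\<bar>" using mult_right_mono[of 1 "\<bar>m\<bar>" "int N"] by (simp add: abs_mult)
      moreover have "\<bar>int a - int b\<bar> < int N" using that by (auto simp: N_def)
      ultimately show False using eq by simp
    qed
    moreover have "(\<zeta> ^ a / \<zeta> ^ b) ^ N = 1"
    proof -
      have "\<zeta> ^ N = 1" unfolding \<zeta>_def Complex.DeMoivre by (simp add: N_def del: of_nat_Suc)
      moreover have "(\<zeta> ^ a / \<zeta> ^ b) ^ N = (\<zeta> ^ N) ^ a / (\<zeta> ^ N) ^ b"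
        by (simp only: power_divide power_mult[symmetric] mult.commute)
      ultimately show ?thesis by simp
    qed
    ultimately show ?thesis using False by (simp only: sum_gp_strict if_False diff_self div_0)
  qed (use nz in simp)
  have "0 = (\<Sum>j\<in>J. (\<Prod>i\<in>UNIV. inverse (\<zeta> ^ (q i * j i))) *
      (\<Sum>p | mi_deg p = k. mi_power (z j) p * d p))"
    using assms(1)[OF zb] by simp
  also have "\<dots> = (\<Sum>p | mi_deg p = k. \<Sum>j\<in>J. of_real c ^ k * d p * (\<Prod>i\<in>UNIV. (\<zeta> ^ p i / \<zeta> ^ q i) ^ j i))"
    unfolding sum_distrib_left
  proof (subst sum.swap, intro sum.cong refl)
    fix p j assume "p \<in> {p :: 'n \<Rightarrow> nat. mi_deg p = k}"
    then have pk: "(\<Prod>i\<in>UNIV. of_real c ^ p i) = (of_real c ^ k :: complex)"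
      by (simp add: mi_deg_def flip: power_sum)
    have "mi_power (z j) p = of_real c ^ k * (\<Prod>i\<in>UNIV. \<zeta> ^ (p i * j i))"
      by (simp add: mi_power_def z_def power_mult_distrib prod.distrib pk mult.commute flip: power_mult)
    then show "(\<Prod>i\<in>UNIV. inverse (\<zeta> ^ (q i * j i))) * (mi_power (z j) p * d p) =
        of_real c ^ k * d p * (\<Prod>i\<in>UNIV. (\<zeta> ^ p i / \<zeta> ^ q i) ^ j i)"
      by (simp add: divide_inverse power_mult_distrib prod.distrib power_mult power_inverse)
  qed
  also have "\<dots> = (\<Sum>p | mi_deg p = k. of_real c ^ k * d p *
      (\<Prod>i\<in>UNIV. \<Sum>j<N. (\<zeta> ^ p i / \<zeta> ^ q i) ^ j))"
    unfolding J_def by (simp add: prod_sum_PiE sum_distrib_left)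
  also have "\<dots> = (\<Sum>p | mi_deg p = k. of_real c ^ k * d p * (if p = q then of_nat N ^ CARD('n) else 0))"
  proof (intro sum.cong refl arg_cong2[where f = "(*)"])
    fix p :: "'n \<Rightarrow> nat" assume "p \<in> {p. mi_deg p = k}"
    then have "(\<Prod>i\<in>UNIV. \<Sum>j<N. (\<zeta> ^ p i / \<zeta> ^ q i) ^ j) =
        (\<Prod>i\<in>UNIV. if p i = q i then of_nat N else 0)"
      by (intro prod.cong refl geo le q) auto
    also have "\<dots> = (if p = q then of_nat N ^ CARD('n) else 0)"
      by (auto simp: fun_eq_iff intro!: prod_zero)
    finally show "(\<Prod>i\<in>UNIV. \<Sum>j<N. (\<zeta> ^ p i / \<zeta> ^ q i) ^ j) = (if p = q then of_nat N ^ CARD('n) else 0)" .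
  qed
  also have "\<dots> = of_real c ^ k * d q * of_nat N ^ CARD('n)"
    using q by (simp add: if_distrib[of "\<lambda>x. _ * x"] finite_mi_deg cong: if_cong)
  finally show "d q = 0" using c by (simp add: N_def del: of_nat_Suc)
qed

lemma ball_series_unique:
  fixes f :: "complex ^ 'n \<Rightarrow> complex"
  assumes "ball_series f a" "ball_series f b"
  shows "a = b"
proof
  fix q :: "'n \<Rightarrow> nat"
  define d where "d p = a p - b p" for p
  have d0: "((\<lambda>p. mi_power z p * d p) has_sum 0) UNIV" if "z \<in> ball 0 1" for z
  proof -
    have "((\<lambda>p. mi_power z p * a p + - (mi_power z p * b p)) has_sum (f z + - f z)) UNIV"
      using assms that by (intro has_sum_add) (auto simp: ball_series_def has_sum_uminus)
    then show ?thesis by (simp add: d_def algebra_simps)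
  qed
  have hom: "(\<Sum>p | mi_deg p = k. mi_power z p * d p) = 0" if z: "z \<in> ball 0 1" for z k
  proof -
    define P where "P k = (\<Sum>p | mi_deg p = k. mi_power z p * d p)" for k
    have s: "(\<lambda>k. P k * t ^ k) sums 0" if t: "norm t < 1" for t
    proof -
      define y :: "complex ^ 'n" where "y = (\<chi> i. t * z $ i)"
      have "norm y = norm t * norm z"
        by (simp add: y_def norm_vec_def norm_mult L2_set_right_distrib)
      also have "\<dots> \<le> 1 * norm z" using t by (intro mult_right_mono) auto
      also have "\<dots> < 1" using z by simp
      finally have "y \<in> ball 0 1" by simp
      then have h: "((\<lambda>p. mi_power y p * d p) has_sum 0) UNIV" by (rule d0)
      have "((\<lambda>(k, p). mi_power y p * d p) has_sum 0) (SIGMA k:UNIV. {p. mi_deg p = k})"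
        using h by (subst has_sum_reindex_bij_witness[where i = "\<lambda>p. (mi_deg p, p)" and j = snd
          and T = UNIV and h = "\<lambda>p. mi_power y p * d p" and s' = 0]) auto
      moreover have "((\<lambda>p. mi_power y p * d p) has_sum (P k * t ^ k)) {p. mi_deg p = k}" for k
      proof (rule has_sum_finiteI[OF finite_mi_deg])
        have "mi_power y p = mi_power z p * t ^ k" if "mi_deg p = k" for p
          using that by (auto simp: mi_power_def y_def power_mult_distrib prod.distrib mi_deg_def power_sum)
        then show "P k * t ^ k = (\<Sum>p | mi_deg p = k. mi_power y p * d p)"
          by (simp add: P_def sum_distrib_left sum_distrib_right mult_ac)
      qed
      ultimately have "((\<lambda>k. P k * t ^ k) has_sum 0) UNIV"
        by (rule has_sum_SigmaD[where f = "\<lambda>(k, p). mi_power y p * d p", unfolded prod.case])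
      then show ?thesis by (rule has_sum_imp_sums)
    qed
    have "Abs_fps P = 0"
    proof (rule eval_fps_eqD)
      have "summable (\<lambda>k. fps_nth (Abs_fps P) k * (1/2) ^ k)"
        using s[of "1/2"] by (auto simp: sums_iff)
      then have "norm (1/2 :: complex) \<le> fps_conv_radius (Abs_fps P)"
        unfolding fps_conv_radius_def by (rule conv_radius_geI)
      then show "fps_conv_radius (Abs_fps P) > 0" by (rule less_le_trans[rotated]) simp
      have "\<forall>\<^sub>F t in nhds 0. t \<in> ball (0::complex) 1" by (intro eventually_nhds_in_open) auto
      then show "\<forall>\<^sub>F t in nhds 0. eval_fps (Abs_fps P) t = eval_fps 0 t"
        by eventually_elim (use s in \<open>auto simp: eval_fps_def sums_iff\<close>)
    qed simp
    then show ?thesis unfolding P_def[symmetric] by (metis fps_nth_Abs_fps fps_zero_nth)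
  qed
  have "d q = 0" by (rule homogeneous_zero[OF hom refl])
  then show "a q = b q" by (simp add: d_def)
qed

lemma ball_coeffs_eq: "ball_series f a \<Longrightarrow> ball_coeffs f = a"
  unfolding ball_coeffs_def by (rule the_equality) (auto intro: ball_series_unique)

definition sym_op :: "(('n::finite \<Rightarrow> nat) \<Rightarrow> complex) \<Rightarrow> real \<Rightarrow> 'n fock \<Rightarrow>\<^sub>L 'n fock" where
  "sym_op a r = (\<Sum>k. \<Sum>p | mi_deg p = k. op_scaleC (of_real r ^ k * a p) (sym_monomial p))"

definition Hinf_sym :: "(complex ^ 'n \<Rightarrow> complex) set" where
  "Hinf_sym = {f. \<exists>a. ball_series f a \<and>
     limsup (\<lambda>k. ereal (root (2 * k)
       (\<Sum>p | mi_deg p = k. fact (mi_deg p) / real (mi_fact p) * (cmod (a p))\<^sup>2))) \<le> 1 \<and>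
     bdd_above ((\<lambda>r. norm (sym_op a r)) ` {0..<1})}"

definition norm_sym :: "(complex ^ 'n \<Rightarrow> complex) \<Rightarrow> real" where
  "norm_sym f = (SUP r\<in>{0..<1}. norm (sym_op (ball_coeffs f) r))"

section \<open>The radii\<close>

definition bohr_sum :: "nat \<Rightarrow> real \<Rightarrow> real" where
  "bohr_sum m t = (\<Sum>k=1..m-1. t ^ k * cos (pi / (real ((m - 1) div k) + 2)))"

definition bohr_radius :: "enat \<Rightarrow> real" where
  "bohr_radius m = (case m of
     enat N \<Rightarrow> (THE t. 0 < t \<and> t \<le> 1 \<and> bohr_sum N t = 1 / 2)
   | \<infinity> \<Rightarrow> 1 / 3)"

lemma bohr_sum_unique_solution:
  assumes "m \<ge> 2"
  shows "\<exists>!t. 0 < t \<and> t \<le> 1 \<and> bohr_sum m t = 1 / 2"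
proof -
  define c where "c k = cos (pi / (real ((m - 1) div k) + 2))" for k
  have c: "c k \<ge> 1 / 2" if "k \<in> {1..m-1}" for k
  proof -
    have "(m - 1) div k \<ge> 1" using that by (simp add: div_greater_zero_iff Suc_le_eq)
    then have "pi / (real ((m - 1) div k) + 2) \<le> pi / 3" by (intro divide_left_mono) auto
    then have "c k \<ge> cos (pi / 3)" unfolding c_def by (intro cos_monotone_0_pi_le) auto
    then show ?thesis by (simp add: cos_60)
  qed
  have b: "bohr_sum m t = (\<Sum>k=1..m-1. t ^ k * c k)" for t by (simp add: bohr_sum_def c_def)
  have mono: "bohr_sum m s < bohr_sum m t" if "0 \<le> s" "s < t" for s t
    unfolding b
  proof (rule sum_strict_mono)
    show "{1..m-1} \<noteq> {}" using assms by auto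
    fix k assume k: "k \<in> {1..m-1}"
    then have "s ^ k < t ^ k" using that by (intro power_strict_mono) auto
    then show "s ^ k * c k < t ^ k * c k" using c[OF k] by (intro mult_strict_right_mono) auto
  qed simp
  have "bohr_sum m 0 = 0" unfolding b by (rule sum.neutral) (auto simp: power_0_left)
  moreover have "bohr_sum m 1 \<ge> 1 / 2"
  proof -
    have "1 / 2 \<le> (1::real) ^ 1 * c 1" using c[of 1] assms by simp
    also have "\<dots> \<le> bohr_sum m 1"
      unfolding b using assms c by (intro member_le_sum) (auto intro: order_trans[of 0 "1/2"])
    finally show ?thesis .
  qed
  moreover have "continuous_on {0..1} (bohr_sum m)"
    unfolding b[abs_def] by (intro continuous_intros)
  ultimately obtain t where t: "0 \<le> t" "t \<le> 1" "bohr_sum m t = 1 / 2"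
    using IVT'[of "bohr_sum m" 0 "1/2" 1] by auto
  show ?thesis
  proof (rule ex1I[of _ t])
    show "0 < t \<and> t \<le> 1 \<and> bohr_sum m t = 1 / 2"
      using t \<open>bohr_sum m 0 = 0\<close> by (cases "t = 0") auto
    show "s = t" if "0 < s \<and> s \<le> 1 \<and> bohr_sum m s = 1 / 2" for s
      using mono[of s t] mono[of t s] t that by (cases s t rule: linorder_cases) auto
  qed
qed

end

theory Submission
  imports Defs "HOL-Combinatorics.Multiset_Permutations"
begin

text \<open>
  Write \<open>f\<^sub>s\<^sub>y\<^sub>m(rS) = \<Sum>k. r\<^sup>k A\<^sub>k\<close> with \<open>A\<^sub>k\<close> homogeneous of degree \<open>k\<close>.  The creation operators are isometries with
  orthogonal ranges, so \<open>A\<^sub>k\<close> is a multiple of an isometry and, by Cauchy-Schwarz over words, the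
  \<open>k\<close>-th summand of the Bohr sum is at most \<open>\<parallel>\<lambda>\<parallel>\<^sup>k \<parallel>A\<^sub>k\<parallel>\<close>.  With \<open>C = \<parallel>f\<parallel>\<^sub>s\<^sub>y\<^sub>m\<close>, the real part of
  \<open>C - \<omega> f\<^sub>s\<^sub>y\<^sub>m(r e\<^sup>i\<^sup>\<theta> S)\<close> is nonnegative whenever \<open>|\<omega>| = 1\<close>; as a trigonometric polynomial in \<open>\<theta>\<close> of degree \<open>m - 1\<close> it
  satisfies Fejer's inequality, which gives
  \<open>\<parallel>A\<^sub>k\<parallel> \<le> 2 cos (pi / ([(m - 1) / k] + 2)) (C - |a\<^sub>0|)\<close>, and \<open>\<parallel>A\<^sub>k\<parallel> \<le> 2 (C - |a\<^sub>0|)\<close> for \<open>m = \<infinity>\<close>.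
  Summing with \<open>\<parallel>\<lambda>\<parallel> \<le> t\<^sub>m\<close> yields \<open>|a\<^sub>0| + (C - |a\<^sub>0|) = C\<close>.
\<close>

section \<open>Coordinate calculus in the Fock space\<close>

lemma coord_add: "coord (\<phi> + \<psi>) w = coord \<phi> w + coord \<psi> w"
  by transfer simp

lemma coord_scaleR: "coord (r *\<^sub>R \<phi>) w = r *\<^sub>R coord \<phi> w"
  by transfer simp

lemma coord_zero: "coord 0 w = 0"
  by transfer simp

lemma coord_sum: "coord (\<Sum>i\<in>I. g i) w = (\<Sum>i\<in>I. coord (g i) w)"
  by (induction I rule: infinite_finite_induct) (simp_all add: coord_zero coord_add)

lemma fock_eqI: "(\<And>w. coord \<phi> w = coord \<psi> w) \<Longrightarrow> \<phi> = \<psi>"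
  by transfer auto

text \<open>Orthogonality below always comes from disjoint supports: ranges of distinct words of one
  length, or vectors of different degrees.\<close>

lemma inner_fock_eq_0:
  assumes "\<And>w. coord \<phi> w = 0 \<or> coord \<psi> w = 0"
  shows "\<phi> \<bullet> \<psi> = 0"
proof -
  have "(\<lambda>w. coord \<phi> w \<bullet> coord \<psi> w) = (\<lambda>_. 0)"
    using assms by (metis inner_zero_left inner_zero_right)
  then show ?thesis by (simp add: inner_fock.rep_eq)
qed

lemma fock_scaleC_of_real: "fock_scaleC (of_real r) \<phi> = r *\<^sub>R \<phi>"
  by transfer (simp add: scaleR_conv_of_real)

lemma fock_scaleC_scaleC: "fock_scaleC b (fock_scaleC c \<phi>) = fock_scaleC (b * c) \<phi>"
  by transfer (simp add: mult.assoc)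

lemma fock_scaleC_sum_left: "fock_scaleC (\<Sum>i\<in>I. c i) \<phi> = (\<Sum>i\<in>I. fock_scaleC (c i) \<phi>)"
  by (rule fock_eqI) (simp add: coord_sum fock_scaleC.rep_eq sum_distrib_right)

lemma fock_scaleC_scaleR: "fock_scaleC (t *\<^sub>R c) \<phi> = t *\<^sub>R fock_scaleC c \<phi>"
  by (rule fock_eqI) (simp add: coord_scaleR fock_scaleC.rep_eq)

lemma norm_fock_scaleC: "norm (fock_scaleC c \<phi>) = cmod c * norm \<phi>"
proof -
  have "(norm (fock_scaleC c \<phi>))\<^sup>2 = (cmod c * norm \<phi>)\<^sup>2"
    unfolding power_mult_distrib norm_fock_sq fock_scaleC.rep_eq
    by (simp add: norm_mult power_mult_distrib infsum_cmult_right')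
  then show ?thesis by (simp add: power2_eq_iff_nonneg)
qed

section \<open>Homogeneous operators\<close>

lemma coord_creation_word:
  "coord (creation_word \<alpha> \<phi>) w =
     (if take (length \<alpha>) w = \<alpha> then coord \<phi> (drop (length \<alpha>) w) else 0)"
proof (induction \<alpha> arbitrary: w)
  case (Cons i \<alpha>)
  then show ?case
    by (cases w) (auto simp: creation_apply tensor_left.rep_eq axis_def)
qed simp

lemma norm_creation_word: "norm (creation_word \<alpha> \<phi>) = norm \<phi>"
  by (induction \<alpha>) (simp_all add: creation_apply norm_tensor_left)

lemma finite_words: "finite {\<alpha> :: 'n::finite list. length \<alpha> = k}"
  using finite_lists_length_eq[of "UNIV :: 'n set" k] by simp

text \<open>Coefficients sit on words rather than multi-indices, since distinct words of equal
  length give isometries with orthogonal ranges. \<open>sym_coeff\<close> recovers the symmetric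
  case.\<close>

definition hom_op :: "('n list \<Rightarrow> complex) \<Rightarrow> nat \<Rightarrow> 'n::finite fock \<Rightarrow>\<^sub>L 'n fock" where
  "hom_op c k = (\<Sum>\<alpha> | length \<alpha> = k. op_scaleC (c \<alpha>) (creation_word \<alpha>))"

definition hom_norm :: "('n::finite list \<Rightarrow> complex) \<Rightarrow> nat \<Rightarrow> real" where
  "hom_norm c k = sqrt (\<Sum>\<alpha> | length \<alpha> = k. (cmod (c \<alpha>))\<^sup>2)"

lemma hom_norm_nonneg: "hom_norm c k \<ge> 0"
  by (simp add: hom_norm_def sum_nonneg)

lemma hom_op_apply:
  "hom_op c k \<phi> = (\<Sum>\<alpha> | length \<alpha> = k. fock_scaleC (c \<alpha>) (creation_word \<alpha> \<phi>))"
  by (simp add: hom_op_def blinfun.sum_left op_scaleC_apply)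

text \<open>Only the summand whose word is the prefix \<open>take k w\<close> reaches the coordinate
  at \<open>w\<close>, so degrees rise by exactly \<open>k\<close>.\<close>

lemma coord_hom_op:
  "coord (hom_op c k \<phi>) w = (if k \<le> length w then c (take k w) * coord \<phi> (drop k w) else 0)"
proof -
  have "coord (hom_op c k \<phi>) w =
      (\<Sum>\<alpha> | length \<alpha> = k. if \<alpha> = take k w then c \<alpha> * coord \<phi> (drop k w) else 0)"
    unfolding hom_op_apply coord_sum fock_scaleC.rep_eq coord_creation_word
    by (rule sum.cong) (simp_all add: eq_commute)
  also have "\<dots> = (if k \<le> length w then c (take k w) * coord \<phi> (drop k w) else 0)"
    by (subst sum.delta[OF finite_words]) (auto simp: min_def)
  finally show ?thesis .
qed

text \<open>The isometries \<open>S\<^sub>\<alpha>\<close>, \<open>|\<alpha>| = k\<close>, have pairwise orthogonal ranges.\<close>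

lemma norm_hom_op: "norm (hom_op c k \<phi>) = hom_norm c k * norm \<phi>"
proof -
  have "(norm (hom_op c k \<phi>))\<^sup>2 = (\<Sum>\<alpha> | length \<alpha> = k. (norm (fock_scaleC (c \<alpha>) (creation_word \<alpha> \<phi>)))\<^sup>2)"
    unfolding hom_op_apply
    by (rule norm_sum_Pythagorean[OF finite_words])
      (auto simp: pairwise_def orthogonal_def fock_scaleC.rep_eq coord_creation_word
        intro!: inner_fock_eq_0)
  also have "\<dots> = (hom_norm c k * norm \<phi>)\<^sup>2"
    by (simp add: norm_fock_scaleC norm_creation_word power_mult_distrib hom_norm_def
        sum_nonneg sum_distrib_right)
  finally show ?thesis
    by (simp add: power2_eq_iff_nonneg hom_norm_nonneg)
qed

lemma norm_hom_op_le: "norm (hom_op c k) \<le> hom_norm c k"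
  by (rule norm_blinfun_bound) (simp_all add: norm_hom_op hom_norm_nonneg)

section \<open>Words and multi-indices\<close>

lemma word_power_count: "word_power z \<alpha> = mi_power z (count_list \<alpha>)"
proof (induction \<alpha>)
  case (Cons i \<alpha>)
  have "mi_power z (count_list (i # \<alpha>)) =
      (\<Prod>j\<in>UNIV. (if j = i then z $ j else 1) * (z $ j) ^ count_list \<alpha> j)"
    unfolding mi_power_def by (intro prod.cong) auto
  also have "\<dots> = z $ i * mi_power z (count_list \<alpha>)"
    by (simp add: prod.distrib mi_power_def)
  finally show ?case using Cons.IH by (simp add: word_power_def del: count_list.simps)
qed (simp add: word_power_def mi_power_def)

text \<open>Each monomial is its own power series with a single coefficient 1, so uniqueness of ball
  expansions separates exponents.\<close>

lemma mi_power_inject: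
  assumes "\<And>z :: complex ^ 'n. z \<in> ball 0 1 \<Longrightarrow> mi_power z p = mi_power z q"
  shows "p = q"
proof -
  have b: "ball_series (\<lambda>z. mi_power z p) (\<lambda>q. if q = p then 1 else 0)" for p :: "'n \<Rightarrow> nat"
    unfolding ball_series_def
  proof
    fix z :: "complex ^ 'n"
    have "((\<lambda>q. mi_power z q * (if q = p then 1 else 0)) has_sum mi_power z p) {p}"
      by (rule has_sum_finiteI) auto
    then show "((\<lambda>q. mi_power z q * (if q = p then 1 else 0)) has_sum mi_power z p) UNIV"
      by (rule has_sum_cong_neutral[THEN iffD1, rotated -1]) auto
  qed
  have "ball_series (\<lambda>z. mi_power z p) (\<lambda>r. if r = q then 1 else 0)"
    using b[of q] assms unfolding ball_series_def by auto
  from ball_series_unique[OF b this] show ?thesis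
    by (auto simp: fun_eq_iff[of "\<lambda>r. if r = p then 1 else 0"] split: if_splits dest: spec[of _ p])
qed

text \<open>Replaces the analytic description of the word class by letter counts, which makes it
  accessible to combinatorics.\<close>

lemma mi_words_eq: "mi_words p = {\<alpha>. count_list \<alpha> = p}"
  using mi_power_inject[of _ p] by (auto simp: mi_words_def word_power_count simp del: mem_ball_0)

lemma mi_deg_count_list: "mi_deg (count_list \<alpha>) = length \<alpha>"
  using sum_count_set[of \<alpha> UNIV] by (simp add: mi_deg_def)

text \<open>The words of type \<open>p\<close> are the arrangements of the multiset with
  multiplicities \<open>p\<close>; their number is multinomial.\<close>

lemma card_mi_words: "card (mi_words p) * mi_fact p = fact (mi_deg p)"
proof -
  define A where "A = Abs_multiset p"
  have c: "count A = p"
    by (simp add: A_def Abs_multiset_inverse)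
  have "mi_words p = permutations_of_multiset A"
    by (auto simp: mi_words_eq permutations_of_multiset_def multiset_eq_iff c count_mset fun_eq_iff)
  moreover have "size A = mi_deg p"
    unfolding size_multiset_overloaded_eq mi_deg_def c
    by (rule sum.mono_neutral_left) (auto simp: not_in_iff c)
  moreover have "(\<Prod>x\<in>set_mset A. fact (count A x)) = mi_fact p"
    unfolding mi_fact_def c
    by (rule prod.mono_neutral_left) (auto simp: not_in_iff c)
  ultimately show ?thesis
    using card_permutations_of_multiset_aux[of A] by (simp add: mult.commute)
qed

lemma sum_words_by_type:
  fixes g :: "'n::finite list \<Rightarrow> 'b::comm_monoid_add"
  shows "(\<Sum>\<alpha> | length \<alpha> = k. g \<alpha>) = (\<Sum>p | mi_deg p = k. \<Sum>\<alpha>\<in>mi_words p. g \<alpha>)"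
proof -
  have "(\<Sum>\<alpha> | length \<alpha> = k. g \<alpha>) =
      (\<Sum>p | mi_deg p = k. sum g {\<alpha> \<in> {\<alpha>. length \<alpha> = k}. count_list \<alpha> = p})"
    by (rule sum.group[symmetric]) (auto simp: finite_words finite_mi_deg mi_deg_count_list)
  also have "\<dots> = (\<Sum>p | mi_deg p = k. \<Sum>\<alpha>\<in>mi_words p. g \<alpha>)"
    by (intro sum.cong refl) (auto simp: mi_words_eq mi_deg_count_list)
  finally show ?thesis .
qed

text \<open>Splitting off the first letter produces one factor \<open>(norm z)\<^sup>2\<close> per
  letter. This is the word side of the Cauchy-Schwarz estimate.\<close>

lemma sum_word_power:
  fixes z :: "complex ^ 'n"
  shows "(\<Sum>\<alpha> | length \<alpha> = k. (cmod (word_power z \<alpha>))\<^sup>2) = norm z ^ (2 * k)"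
proof (induction k)
  case (Suc k)
  have "{\<alpha> :: 'n list. length \<alpha> = Suc k} = (\<lambda>(i, \<alpha>). i # \<alpha>) ` (UNIV \<times> {\<alpha>. length \<alpha> = k})"
    by (auto simp: length_Suc_conv)
  then have "(\<Sum>\<alpha> | length \<alpha> = Suc k. (cmod (word_power z \<alpha>))\<^sup>2) =
      (\<Sum>(i, \<alpha>)\<in>UNIV \<times> {\<alpha>. length \<alpha> = k}. (cmod (z $ i))\<^sup>2 * (cmod (word_power z \<alpha>))\<^sup>2)"
    by (simp add: sum.reindex inj_on_def case_prod_unfold word_power_def norm_mult power_mult_distrib)
  also have "\<dots> = (\<Sum>i\<in>UNIV. (cmod (z $ i))\<^sup>2) * norm z ^ (2 * k)"
    by (simp add: sum.cartesian_product[symmetric] sum_product Suc.IH[symmetric])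
  also have "(\<Sum>i\<in>UNIV. (cmod (z $ i))\<^sup>2) = (norm z)\<^sup>2"
    by (simp add: norm_vec_def L2_set_def sum_nonneg)
  finally show ?case by (simp add: power2_eq_square)
qed (simp add: word_power_def)

section \<open>Symmetrized series as series over words\<close>

definition sym_coeff :: "(('n::finite \<Rightarrow> nat) \<Rightarrow> complex) \<Rightarrow> 'n list \<Rightarrow> complex" where
  "sym_coeff a \<alpha> =
     of_real (real (mi_fact (count_list \<alpha>)) / fact (length \<alpha>)) * a (count_list \<alpha>)"

lemma sym_coeff_mi_words:
  "\<alpha> \<in> mi_words p \<Longrightarrow> sym_coeff a \<alpha> = of_real (real (mi_fact p) / fact (mi_deg p)) * a p"
  by (auto simp: sym_coeff_def mi_words_eq mi_deg_count_list)

lemma mi_fact_pos: "mi_fact p > 0"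
  by (simp add: mi_fact_def prod_pos)

lemma sum_mi_words_weight: "real (card (mi_words p)) * (real (mi_fact p) / fact (mi_deg p)) = 1"
  using arg_cong[OF card_mi_words[of p], of real] by (simp add: field_simps)

text \<open>Every word of type \<open>p\<close> carries the same share p!/|p|! of the coefficient,
  so regrouping words by type gives the symmetrized monomials.\<close>

lemma sym_monomials_eq_hom_op:
  "(\<Sum>p | mi_deg p = k. op_scaleC (of_real r ^ k * a p) (sym_monomial p)) =
     r ^ k *\<^sub>R hom_op (sym_coeff a) k"
proof (rule blinfun_eqI)
  fix \<phi> :: "'a fock"
  have "blinfun_apply (op_scaleC (of_real r ^ k * a p) (sym_monomial p)) \<phi> =
      (\<Sum>\<alpha>\<in>mi_words p. r ^ k *\<^sub>R fock_scaleC (sym_coeff a \<alpha>) (creation_word \<alpha> \<phi>))" for p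
    by (rule fock_eqI)
      (simp add: op_scaleC_apply sym_monomial_def blinfun.scaleR_left blinfun.sum_left
        fock_scaleC.rep_eq coord_sum coord_scaleR sum_distrib_left sym_coeff_mi_words
        scaleR_conv_of_real mult_ac cong: sum.cong)
  then show "blinfun_apply (\<Sum>p | mi_deg p = k. op_scaleC (of_real r ^ k * a p) (sym_monomial p)) \<phi> =
      blinfun_apply (r ^ k *\<^sub>R hom_op (sym_coeff a) k) \<phi>"
    by (simp add: blinfun.sum_left blinfun.scaleR_left hom_op_apply sum_words_by_type scaleR_sum_right)
qed

text \<open>The squared norm is really the sum of p!/|p|! times the squared moduli. The growth
  condition uses the reciprocal weight, which is at least as large because p!/|p|! is at most
  1.\<close>

lemma hom_norm_sym_coeff_le:
  "hom_norm (sym_coeff a) k \<le>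
     sqrt (\<Sum>p | mi_deg p = k. fact (mi_deg p) / real (mi_fact p) * (cmod (a p))\<^sup>2)"
  unfolding hom_norm_def sum_words_by_type
proof (intro real_sqrt_le_mono sum_mono)
  fix p :: "'a \<Rightarrow> nat"
  define x where "x = real (mi_fact p) / fact (mi_deg p)"
  have x: "x > 0" by (simp add: x_def mi_fact_pos)
  have c: "real (card (mi_words p)) * x = 1" unfolding x_def by (rule sum_mi_words_weight)
  then have "card (mi_words p) \<noteq> 0" by (cases "card (mi_words p)") auto
  then have "1 \<le> real (card (mi_words p))" by simp
  then have "x \<le> 1" using c x mult_right_mono[of 1 "real (card (mi_words p))" x] by simp
  then have le: "x \<le> 1 / x" using x by (simp add: field_simps mult_le_one)
  have "(\<Sum>\<alpha>\<in>mi_words p. (cmod (sym_coeff a \<alpha>))\<^sup>2) = (\<Sum>\<alpha>\<in>mi_words p. x\<^sup>2 * (cmod (a p))\<^sup>2)"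
    by (intro sum.cong refl) (simp add: sym_coeff_mi_words norm_mult power_mult_distrib x_def[symmetric])
  also have "\<dots> = real (card (mi_words p)) * x * (x * (cmod (a p))\<^sup>2)"
    by (simp add: power2_eq_square)
  also have "\<dots> \<le> 1 / x * (cmod (a p))\<^sup>2"
    unfolding c mult_1 by (rule mult_right_mono[OF le]) simp
  finally show "(\<Sum>\<alpha>\<in>mi_words p. (cmod (sym_coeff a \<alpha>))\<^sup>2) \<le>
      fact (mi_deg p) / real (mi_fact p) * (cmod (a p))\<^sup>2" by (simp add: x_def)
qed

text \<open>Since p!/|p|! times the number of words of type \<open>p\<close> is 1, the sum becomes a
  pairing of two functions on words, and Cauchy-Schwarz applies.\<close>

lemma homogeneous_part_le:
  fixes z :: "complex ^ 'n"
  shows "cmod (\<Sum>p | mi_deg p = k. mi_power z p * of_real (cmod (a p)))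
    \<le> norm z ^ k * hom_norm (sym_coeff a) k"
proof -
  have "(\<Sum>p | mi_deg p = k. mi_power z p * of_real (cmod (a p))) =
      (\<Sum>\<alpha> | length \<alpha> = k. word_power z \<alpha> * of_real (cmod (sym_coeff a \<alpha>)))"
    unfolding sum_words_by_type
  proof (intro sum.cong refl)
    fix p :: "'n \<Rightarrow> nat"
    define x where "x = real (mi_fact p) / fact (mi_deg p)"
    have x: "x > 0" by (simp add: x_def mi_fact_pos)
    have "(\<Sum>\<alpha>\<in>mi_words p. word_power z \<alpha> * of_real (cmod (sym_coeff a \<alpha>))) =
        (\<Sum>\<alpha>\<in>mi_words p. mi_power z p * of_real (x * cmod (a p)))"
    proof (intro sum.cong refl)
      fix \<alpha> assume \<alpha>: "\<alpha> \<in> mi_words p"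
      have "cmod (sym_coeff a \<alpha>) = x * cmod (a p)"
        unfolding sym_coeff_mi_words[OF \<alpha>] x_def[symmetric] using x by (simp add: norm_mult)
      moreover have "word_power z \<alpha> = mi_power z p"
        using \<alpha> by (auto simp: mi_words_eq word_power_count)
      ultimately show "word_power z \<alpha> * of_real (cmod (sym_coeff a \<alpha>)) = mi_power z p * of_real (x * cmod (a p))"
        by simp
    qed
    also have "\<dots> = of_real (real (card (mi_words p)) * x) * (mi_power z p * of_real (cmod (a p)))"
      by simp
    also have "\<dots> = mi_power z p * of_real (cmod (a p))"
      unfolding x_def sum_mi_words_weight by simp
    finally show "mi_power z p * of_real (cmod (a p)) =
        (\<Sum>\<alpha>\<in>mi_words p. word_power z \<alpha> * of_real (cmod (sym_coeff a \<alpha>)))" ..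
  qed
  also have "cmod \<dots> \<le> (\<Sum>\<alpha> | length \<alpha> = k. \<bar>cmod (word_power z \<alpha>)\<bar> * \<bar>cmod (sym_coeff a \<alpha>)\<bar>)"
    by (rule order.trans[OF norm_sum]) (simp add: norm_mult)
  also have "\<dots> \<le> L2_set (\<lambda>\<alpha>. cmod (word_power z \<alpha>)) {\<alpha>. length \<alpha> = k} *
      L2_set (\<lambda>\<alpha>. cmod (sym_coeff a \<alpha>)) {\<alpha>. length \<alpha> = k}"
    by (rule L2_set_mult_ineq)
  also have "\<dots> = norm z ^ k * hom_norm (sym_coeff a) k"
    by (simp add: L2_set_def sum_word_power hom_norm_def power_even_eq)
  finally show ?thesis .
qed

lemma summable_hom_op:
  fixes a :: "('n::finite \<Rightarrow> nat) \<Rightarrow> complex"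
  assumes lim: "limsup (\<lambda>k. ereal (root (2 * k)
       (\<Sum>p | mi_deg p = k. fact (mi_deg p) / real (mi_fact p) * (cmod (a p))\<^sup>2))) \<le> 1"
    and r: "0 \<le> r" "r < 1"
  shows "summable (\<lambda>k. r ^ k *\<^sub>R hom_op (sym_coeff a) k)"
proof -
  define q where "q k = sqrt (\<Sum>p | mi_deg p = k. fact (mi_deg p) / real (mi_fact p) * (cmod (a p))\<^sup>2)"
    for k
  have q: "q k \<ge> 0" for k by (simp add: q_def sum_nonneg)
  \<comment> \<open>The 2k-th root of the squared quantity is the k-th root of its square root, so
    the growth hypothesis says that \<open>q\<close> has radius of convergence at least 1.\<close>
  have "root k (norm (q k)) = root (2 * k)
       (\<Sum>p | mi_deg p = k. fact (mi_deg p) / real (mi_fact p) * (cmod (a p))\<^sup>2)" for k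
    using q[of k] by (simp add: q_def sqrt_def real_root_mult_exp mult.commute)
  then have "limsup (\<lambda>k. ereal (root k (norm (q k)))) \<le> 1" using lim by simp
  then have "conv_radius q \<ge> 1"
    unfolding conv_radius_def
    using ereal_inverse_antimono[of "limsup (\<lambda>k. ereal (root k (norm (q k))))" 1]
      le_Limsup[of sequentially 0 "\<lambda>k. ereal (root k (norm (q k)))"]
    by (simp add: real_root_ge_zero)
  then have "ereal (norm r) < conv_radius q"
    by (rule less_le_trans[rotated]) (use r in simp)
  then have s: "summable (\<lambda>k. q k * r ^ k)" by (rule summable_in_conv_radius)
  show ?thesis
  proof (rule summable_comparison_test'[OF s])
    fix k
    have "norm (hom_op (sym_coeff a) k) \<le> q k"
      unfolding q_def by (rule order.trans[OF norm_hom_op_le hom_norm_sym_coeff_le])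
    then show "norm (r ^ k *\<^sub>R hom_op (sym_coeff a) k) \<le> q k * r ^ k"
      using r by (simp add: mult.commute[of "q k"] mult_left_mono)
  qed
qed

lemma sym_op_sums:
  assumes "limsup (\<lambda>k. ereal (root (2 * k)
       (\<Sum>p | mi_deg p = k. fact (mi_deg p) / real (mi_fact p) * (cmod (a p))\<^sup>2))) \<le> 1"
    and "0 \<le> r" "r < 1"
  shows "(\<lambda>k. r ^ k *\<^sub>R blinfun_apply (hom_op (sym_coeff a) k) x) sums blinfun_apply (sym_op a r) x"
proof -
  have "(\<lambda>k. r ^ k *\<^sub>R hom_op (sym_coeff a) k) sums sym_op a r"
    unfolding sym_op_def sym_monomials_eq_hom_op
    using summable_hom_op[OF assms] by (rule summable_sums)
  then have "(\<lambda>k. blinfun_apply (r ^ k *\<^sub>R hom_op (sym_coeff a) k) x) sums blinfun_apply (sym_op a r) x"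
    by (rule bounded_linear.sums[OF blinfun.bounded_linear_left])
  then show ?thesis by (simp add: blinfun.scaleR_left)
qed

section \<open>A quadrature formula\<close>

text \<open>Up to a constant phase this is a full geometric sum over powers of a K-th root of unity,
  which differs from 1 because \<open>l\<close> is nonzero and smaller than \<open>K\<close> in
  modulus.\<close>

lemma sum_cis_odd_multiples:
  fixes l :: int
  assumes "l \<noteq> 0" "\<bar>l\<bar> < int K"
  shows "(\<Sum>j<K. cis (of_int l * ((2 * real j + 1) * pi / real K))) = 0"
proof -
  define \<zeta> where "\<zeta> = cis (2 * pi * of_int l / real K)"
  have K: "K > 0" using assms by linarith
  have "\<zeta> \<noteq> 1"
  proof
    assume "\<zeta> = 1"
    then have "cos (2 * pi * of_int l / real K) = 1" by (simp add: \<zeta>_def complex_eq_iff)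
    then obtain n :: int where "2 * pi * of_int l / real K = of_int n * 2 * pi"
      using cos_one_2pi_int by blast
    then have "(2 * pi) * of_int l = (2 * pi) * (of_int n * real K)" using K by (simp add: field_simps)
    then have "of_int l = (of_int (n * int K) :: real)" by simp
    then have l: "l = n * int K" unfolding of_int_eq_iff .
    then have "n \<noteq> 0" using assms(1) by auto
    then have "int K \<le> \<bar>n * int K\<bar>" using mult_right_mono[of 1 "\<bar>n\<bar>" "int K"] by (simp add: abs_mult)
    then show False using assms(2) l by simp
  qed
  moreover have "\<zeta> ^ K = 1"
    unfolding \<zeta>_def Complex.DeMoivre using K by (simp add: cis_multiple_2pi)
  ultimately have "(\<Sum>j<K. \<zeta> ^ j) = 0" by (simp add: sum_gp_strict)
  moreover have "cis (of_int l * ((2 * real j + 1) * pi / real K)) = cis (of_int l * pi / real K) * \<zeta> ^ j" for j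
    unfolding \<zeta>_def Complex.DeMoivre cis_mult by (rule arg_cong[of _ _ cis]) (simp add: field_simps add_divide_distrib)
  ultimately show ?thesis by (simp add: sum_distrib_left[symmetric])
qed

text \<open>After reducing \<open>j\<close> modulo \<open>n\<close>, the difference of the cosines
  is a product of two sines of angles in [0, pi]. This makes the quadrature weights
  nonnegative.\<close>

lemma cos_odd_multiple_le:
  assumes "n > 0"
  shows "cos ((2 * real j + 1) * pi / real n) \<le> cos (pi / real n)"
proof -
  define i where "i = j mod n"
  have i: "i < n" using assms by (simp add: i_def)
  have "real j = real i + real (j div n) * real n"
    unfolding i_def by (metis mod_div_mult_eq of_nat_add of_nat_mult)
  then have "(2 * real j + 1) * pi / real n = (2 * real i + 1) * pi / real n + of_nat (j div n) * (2 * pi)"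
    using assms by (simp add: field_simps)
  then have "cos ((2 * real j + 1) * pi / real n) = cos ((2 * real i + 1) * pi / real n)"
    using cos.plus_of_nat[of "(2 * real i + 1) * pi / real n" "j div n"] by simp
  moreover have "cos (pi / real n) - cos ((2 * real i + 1) * pi / real n) =
      2 * sin (real (i + 1) * pi / real n) * sin (real i * pi / real n)"
  proof -
    have "(pi / real n + (2 * real i + 1) * pi / real n) / 2 = real (i + 1) * pi / real n"
      "((2 * real i + 1) * pi / real n - pi / real n) / 2 = real i * pi / real n"
      by (simp_all add: field_simps add_divide_distrib)
    then show ?thesis unfolding cos_diff_cos by simp
  qed
  moreover have "sin (real k * pi / real n) \<ge> 0" if "k \<le> n" for k
    using that assms by (intro sin_ge_zero) (auto simp: field_simps)
  from this[of "i + 1"] this[of i] i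
  have "2 * sin (real (i + 1) * pi / real n) * sin (real i * pi / real n) \<ge> 0" by simp
  ultimately show ?thesis by linarith
qed

text \<open>
  The measure on the circle that puts mass \<open>(cos (pi / (N + 2)) - cos (k \<theta>)) / K\<close>, with
  \<open>N = L div k\<close>, on the \<open>K = k (N + 2)\<close> points \<open>e\<^sup>i\<^sup>\<theta>\<close> for which \<open>K \<theta>\<close> is an odd multiple of \<open>pi\<close>.  There is no
  aliasing up to degree \<open>L\<close> because \<open>L + k < K\<close>.
\<close>

lemma fejer_quadrature:
  fixes k L :: nat
  assumes "k > 0"
  defines "c \<equiv> cos (pi / (real (L div k) + 2))"
  obtains K :: nat and w \<theta> :: "nat \<Rightarrow> real" where
    "\<And>j. w j \<ge> 0"
    "\<And>l. l \<le> L \<Longrightarrow> (\<Sum>j<K. of_real (w j) * cis (\<theta> j) ^ l) =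
       (if l = 0 then of_real c else if l = k then - 1 / 2 else 0)"
proof -
  define N where "N = L div k"
  define K where "K = k * (N + 2)"
  define \<theta> where "\<theta> j = (2 * real j + 1) * pi / real K" for j
  define w where "w j = (c - cos (real k * \<theta> j)) / real K" for j
  define E where "E l = (\<Sum>j<K. cis (of_int l * \<theta> j))" for l
  have K: "K > 0" using assms by (simp add: K_def)
  have E0: "E l = 0" if "l \<noteq> 0" "\<bar>l\<bar> < int K" for l
    unfolding E_def \<theta>_def by (rule sum_cis_odd_multiples[OF that])
  have "L < k * (N + 1)"
    unfolding N_def using dividend_less_times_div[OF assms(1), of L] by simp
  then have LK: "L + k < K" by (simp add: K_def)
  show ?thesis
  proof (rule that[of w \<theta> K])
    fix j
    \<comment> \<open>The factor \<open>k\<close> in \<open>K\<close> cancels, so only odd multiples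
      of pi/(N + 2) occur.\<close>
    have "real k * \<theta> j = (2 * real j + 1) * pi / real (N + 2)"
      using assms(1) unfolding \<theta>_def K_def of_nat_mult by (simp add: divide_simps)
    moreover have "c = cos (pi / real (N + 2))" by (simp add: c_def N_def add.commute)
    ultimately show "w j \<ge> 0"
      using cos_odd_multiple_le[of "N + 2" j] by (simp add: w_def)
  next
    fix l assume l: "l \<le> L"
    \<comment> \<open>The weight splits the sum into the frequencies \<open>l\<close>,
      \<open>l + k\<close> and \<open>l - k\<close>, all below \<open>K\<close> in modulus. Only
      frequency 0 survives: it yields \<open>c\<close> at \<open>l = 0\<close> and -1/2 at
      \<open>l = k\<close>.\<close>
    have "of_real (w j) * cis (\<theta> j) ^ l = (of_real c * cis (of_int (int l) * \<theta> j)
        - (cis (of_int (int l + int k) * \<theta> j) + cis (of_int (int l - int k) * \<theta> j)) / 2) / of_nat K" for j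
    proof -
      have "of_real (cos x) = (cis x + cis (- x)) / 2" for x by (simp add: complex_eq_iff)
      then show ?thesis
        by (simp add: w_def Complex.DeMoivre algebra_simps cis_mult[symmetric] diff_divide_distrib add_divide_distrib)
          (simp add: cis_mult algebra_simps)
    qed
    then have "(\<Sum>j<K. of_real (w j) * cis (\<theta> j) ^ l) =
        (of_real c * E (int l) - (E (int l + int k) + E (int l - int k)) / 2) / of_nat K"
      by (simp add: E_def sum_divide_distrib[symmetric] sum_subtractf sum.distrib sum_distrib_left)
    moreover have "E 0 = of_nat K" by (simp add: E_def)
    moreover have "E (int l + int k) = 0" using assms(1) l LK by (intro E0) auto
    moreover have "E (int l) = 0" if "l \<noteq> 0" using that l LK by (intro E0) auto
    moreover have "E (int l - int k) = 0" if "l \<noteq> k" using that assms(1) l LK by (intro E0) auto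
    ultimately show "(\<Sum>j<K. of_real (w j) * cis (\<theta> j) ^ l) =
        (if l = 0 then of_real c else if l = k then - 1 / 2 else 0)"
      using K assms(1) by auto
  qed
qed

section \<open>Coefficient estimates\<close>

lift_definition rot :: "real \<Rightarrow> 'n fock \<Rightarrow> 'n fock" is "\<lambda>t \<phi> w. cis (real (length w) * t) * \<phi> w"
  by (simp add: norm_mult)

lemma rot_inner: "rot t \<phi> \<bullet> rot t \<psi> = \<phi> \<bullet> \<psi>"
proof -
  have "(cis s * u) \<bullet> (cis s * v) = u \<bullet> v" for s and u v :: complex
  proof -
    have inner: "x \<bullet> y = Re (cnj x * y)" for x y :: complex by (simp add: inner_complex_def)
    have "(cis s * u) \<bullet> (cis s * v) = Re (cnj (cis s) * cis s * (cnj u * v))"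
      unfolding inner complex_cnj_mult by (simp only: mult_ac)
    also have "cnj (cis s) * cis s = 1" by (simp add: cis_cnj cis_mult)
    finally show ?thesis by (simp add: inner_complex_def)
  qed
  then show ?thesis by (simp add: inner_fock.rep_eq rot.rep_eq)
qed

lemma norm_rot: "norm (rot t \<phi>) = norm \<phi>"
  by (simp add: norm_eq_sqrt_inner rot_inner)

text \<open>Conjugation by the gauge unitary multiplies the degree-k part by e^{ikt}, because the
  tail of a word of length d has length d - k.\<close>

lemma hom_op_rot:
  "hom_op c k (rot (- t) \<phi>) = rot (- t) (fock_scaleC (cis t ^ k) (hom_op c k \<phi>))"
proof (rule fock_eqI)
  fix w :: "'a list"
  show "coord (hom_op c k (rot (- t) \<phi>)) w =
      coord (rot (- t) (fock_scaleC (cis t ^ k) (hom_op c k \<phi>))) w"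
  proof (cases "k \<le> length w")
    case True
    then have "cis (real (length w - k) * - t) = cis (real (length w) * - t) * cis t ^ k"
      by (simp add: Complex.DeMoivre cis_mult of_nat_diff algebra_simps)
    then show ?thesis using True by (simp add: coord_hom_op rot.rep_eq fock_scaleC.rep_eq mult_ac)
  qed (simp add: coord_hom_op rot.rep_eq fock_scaleC.rep_eq)
qed

lemma fock_scaleC_rot: "fock_scaleC b (rot t \<phi>) = rot t (fock_scaleC b \<phi>)"
  by (rule fock_eqI) (simp add: rot.rep_eq fock_scaleC.rep_eq)

lemma fock_scaleC_scaleR_right: "fock_scaleC b (t *\<^sub>R \<phi>) = t *\<^sub>R fock_scaleC b \<phi>"
  by (rule fock_eqI) (simp add: coord_scaleR fock_scaleC.rep_eq)

lemma hom_op_0: "hom_op c 0 \<phi> = fock_scaleC (c []) \<phi>"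
  by (rule fock_eqI) (simp add: coord_hom_op fock_scaleC.rep_eq)

text \<open>The form of the series at angle \<open>t\<close> in \<open>x\<close> equals the form of
  \<open>F\<close> in the rotated vector. Hence one norm bound on \<open>F\<close> serves all
  angles.\<close>

lemma hom_op_rotated_sums:
  fixes F :: "'n::finite fock \<Rightarrow>\<^sub>L 'n fock"
  assumes F: "\<And>x. (\<lambda>l. r ^ l *\<^sub>R blinfun_apply (hom_op c l) x) sums blinfun_apply F x"
    and C: "norm F \<le> C" and \<omega>: "cmod \<omega> = 1"
  obtains S where "(\<lambda>l. r ^ l * (fock_scaleC (\<omega> * cis t ^ l) (hom_op c l x) \<bullet> x)) sums S"
    and "S \<le> C * (norm x)\<^sup>2"
proof (rule that)
  define y where "y = rot (- t) x"
  have ny: "norm y = norm x" by (simp add: y_def norm_rot)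
  have "bounded_linear (\<lambda>v. fock_scaleC \<omega> v \<bullet> y)"
    by (intro bounded_linear_intros bounded_linear_inner_left_comp bounded_linear_fock_scaleC)
  then have "(\<lambda>l. fock_scaleC \<omega> (r ^ l *\<^sub>R blinfun_apply (hom_op c l) y) \<bullet> y) sums (fock_scaleC \<omega> (blinfun_apply F y) \<bullet> y)"
    by (rule bounded_linear.sums) (rule F)
  moreover have "fock_scaleC \<omega> (r ^ l *\<^sub>R blinfun_apply (hom_op c l) y) \<bullet> y =
      r ^ l * (fock_scaleC (\<omega> * cis t ^ l) (hom_op c l x) \<bullet> x)" for l
    unfolding y_def hom_op_rot fock_scaleC_scaleR_right fock_scaleC_rot fock_scaleC_scaleC
    by (simp add: rot_inner)
  ultimately show "(\<lambda>l. r ^ l * (fock_scaleC (\<omega> * cis t ^ l) (hom_op c l x) \<bullet> x)) sums (fock_scaleC \<omega> (blinfun_apply F y) \<bullet> y)"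
    by simp
  have "fock_scaleC \<omega> (blinfun_apply F y) \<bullet> y \<le> norm (fock_scaleC \<omega> (blinfun_apply F y)) * norm y"
    by (rule norm_cauchy_schwarz)
  also have "\<dots> \<le> (norm F * norm y) * norm y"
    using norm_blinfun[of F y] by (simp add: norm_fock_scaleC \<omega> mult_right_mono)
  also have "\<dots> \<le> C * (norm x)\<^sup>2"
    using C by (simp add: ny power2_eq_square mult_right_mono mult.assoc)
  finally show "fock_scaleC \<omega> (blinfun_apply F y) \<bullet> y \<le> C * (norm x)\<^sup>2" .
qed

text \<open>Integrating \<open>C - Re (\<omega> F(e\<^sup>i\<^sup>\<theta> S))\<close>, a nonnegative form, against the quadrature measure.\<close>

lemma fejer_form_bound:
  fixes F :: "'n::finite fock \<Rightarrow>\<^sub>L 'n fock"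
  assumes F: "\<And>x. (\<lambda>l. r ^ l *\<^sub>R blinfun_apply (hom_op c l) x) sums blinfun_apply F x"
    and C: "norm F \<le> C" and k: "k > 0"
    and L: "\<And>l b. l > L \<Longrightarrow> fock_scaleC b (hom_op c l x) \<bullet> x = 0"
  shows "r ^ k * (hom_op c k x \<bullet> x)
    \<le> 2 * cos (pi / (real (L div k) + 2)) * (C - cmod (c [])) * (norm x)\<^sup>2"
proof -
  define q where "q = cos (pi / (real (L div k) + 2))"
  obtain K :: nat and w \<theta> :: "nat \<Rightarrow> real" where w: "\<And>j. w j \<ge> 0" and
    quad: "\<And>l. l \<le> L \<Longrightarrow> (\<Sum>j<K. of_real (w j) * cis (\<theta> j) ^ l) =
       (if l = 0 then of_real q else if l = k then - 1 / 2 else 0)"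
    unfolding q_def using fejer_quadrature[OF k, where L = L] by metis
  \<comment> \<open>\<open>\<omega>\<close> cancels the phase of the constant coefficient.
    \<open>\<beta>\<close> then shifts the nodes so that degree \<open>k\<close> acquires the factor
    -1, which offsets the sign of the moment -1/2.\<close>
  define s where "s = - Arg (c [])"
  define \<omega> where "\<omega> = cis s"
  define \<beta> where "\<beta> = (pi - s) / real k"
  have \<omega>: "cmod \<omega> = 1" by (simp add: \<omega>_def)
  have \<omega>c: "\<omega> * c [] = of_real (cmod (c []))"
  proof -
    have "c [] = rcis (cmod (c [])) (Arg (c []))" by (simp add: rcis_cmod_Arg)
    then have "\<omega> * c [] = cis s * rcis (cmod (c [])) (Arg (c []))" unfolding \<omega>_def by simp
    then show ?thesis by (simp add: rcis_def s_def cis_mult)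
  qed
  have \<omega>\<beta>: "\<omega> * cis \<beta> ^ k = - 1"
    using k by (simp add: \<omega>_def \<beta>_def Complex.DeMoivre cis_mult)
  define B where "B l b = fock_scaleC b (hom_op c l x) \<bullet> x" for l b
  have "\<exists>S. (\<lambda>l. r ^ l * B l (\<omega> * cis (\<theta> j + \<beta>) ^ l)) sums S \<and> S \<le> C * (norm x)\<^sup>2" for j
    unfolding B_def by (rule hom_op_rotated_sums[OF F C \<omega>]) blast
  then obtain S where S: "\<And>j. (\<lambda>l. r ^ l * B l (\<omega> * cis (\<theta> j + \<beta>) ^ l)) sums S j"
    and S_le: "\<And>j. S j \<le> C * (norm x)\<^sup>2" by metis
  define T where "T l = \<omega> * cis \<beta> ^ l * (\<Sum>j<K. of_real (w j) * cis (\<theta> j) ^ l)" for l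
  have "(\<lambda>l. \<Sum>j<K. w j * (r ^ l * B l (\<omega> * cis (\<theta> j + \<beta>) ^ l))) sums (\<Sum>j<K. w j * S j)"
    by (intro sums_sum sums_mult S)
  moreover have "(\<Sum>j<K. w j * (r ^ l * B l (\<omega> * cis (\<theta> j + \<beta>) ^ l))) = r ^ l * B l (T l)" for l
  proof -
    have "T l = (\<Sum>j<K. w j *\<^sub>R (\<omega> * cis (\<theta> j + \<beta>) ^ l))"
      unfolding T_def sum_distrib_left
      by (intro sum.cong refl) (simp add: scaleR_conv_of_real power_mult_distrib cis_mult[symmetric])
    then show ?thesis
      by (simp only: B_def fock_scaleC_sum_left fock_scaleC_scaleR inner_sum_left inner_scaleR_left
          sum_distrib_left mult.left_commute)
  qed
  moreover have "r ^ l * B l (T l) = (if l = 0 then q * cmod (c []) * (norm x)\<^sup>2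
      else if l = k then r ^ k * (hom_op c k x \<bullet> x) / 2 else 0)" for l
  proof (cases "l \<le> L")
    case True
    have "fock_scaleC 0 v = 0" for v :: "'n fock" using fock_scaleC_of_real[of 0 v] by simp
    moreover have "B 0 (\<omega> * of_real q) = q * cmod (c []) * (norm x)\<^sup>2"
    proof -
      have "fock_scaleC (\<omega> * of_real q) (hom_op c 0 x) = fock_scaleC (of_real (q * cmod (c []))) x"
        unfolding hom_op_0 fock_scaleC_scaleC by (simp add: \<omega>c[symmetric] mult_ac)
      then show ?thesis
        by (simp only: B_def fock_scaleC_of_real inner_scaleR_left power2_norm_eq_inner)
    qed
    moreover have "B k (1 / 2) = (hom_op c k x \<bullet> x) / 2"
      using fock_scaleC_of_real[of "1/2" "hom_op c k x"] by (simp add: B_def)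
    ultimately show ?thesis
      unfolding T_def quad[OF True] using \<omega>\<beta> k by (auto simp: B_def)
  next
    case False
    then have "B l b = 0" for b unfolding B_def by (intro L) simp
    \<comment> \<open>This covers \<open>k > L\<close>, where the quadrature formula says nothing
      about degree \<open>k\<close> but its form vanishes.\<close>
    moreover have "hom_op c l x \<bullet> x = 0"
      using L[of l 1] False fock_scaleC_of_real[of 1 "hom_op c l x"] by simp
    ultimately show ?thesis using False by auto
  qed
  ultimately have 1: "(\<lambda>l. if l = 0 then q * cmod (c []) * (norm x)\<^sup>2
      else if l = k then r ^ k * (hom_op c k x \<bullet> x) / 2 else 0) sums (\<Sum>j<K. w j * S j)"
    by simp
  have "(\<lambda>l. if l = 0 then q * cmod (c []) * (norm x)\<^sup>2
      else if l = k then r ^ k * (hom_op c k x \<bullet> x) / 2 else 0) sums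
      (q * cmod (c []) * (norm x)\<^sup>2 + r ^ k * (hom_op c k x \<bullet> x) / 2)"
    using sums_finite[of "{0, k}" "\<lambda>l. if l = 0 then q * cmod (c []) * (norm x)\<^sup>2
      else if l = k then r ^ k * (hom_op c k x \<bullet> x) / 2 else 0"] k by simp
  from sums_unique2[OF this 1]
  have "q * cmod (c []) * (norm x)\<^sup>2 + r ^ k * (hom_op c k x \<bullet> x) / 2 = (\<Sum>j<K. w j * S j)" .
  also have "\<dots> \<le> (\<Sum>j<K. w j * (C * (norm x)\<^sup>2))"
    by (intro sum_mono mult_left_mono S_le w)
  also have "\<dots> = q * (C * (norm x)\<^sup>2)"
  proof -
    \<comment> \<open>The total mass of the quadrature measure is its zeroth moment.\<close>
    have "complex_of_real (\<Sum>j<K. w j) = of_real q" using quad[of 0] by simp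
    then have "(\<Sum>j<K. w j) = q" unfolding of_real_eq_iff .
    then show ?thesis by (simp only: sum_distrib_right[symmetric])
  qed
  finally show ?thesis unfolding q_def[symmetric] by (simp add: algebra_simps)
qed

section \<open>Test vectors generated by the vacuum, and norm bounds\<close>

lift_definition vacuum :: "'n fock" is "\<lambda>w. if w = [] then 1 else 0"
proof -
  have "finite {w :: 'n list. w \<in> UNIV \<and> (cmod (if w = [] then 1 else 0))\<^sup>2 \<noteq> 0}" by simp
  then show "(\<lambda>w :: 'n list. (cmod (if w = [] then 1 else 0))\<^sup>2) summable_on UNIV"
    by (rule finite_nonzero_values_imp_summable_on[rotated -1]) 
qed

lemma norm_vacuum: "norm (vacuum :: 'n fock) = 1"
proof -
  have "((\<lambda>w :: 'n list. (cmod (coord vacuum w))\<^sup>2) has_sum 1) {[]}"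
    by (rule has_sum_finiteI) (auto simp: vacuum.rep_eq)
  then have "((\<lambda>w :: 'n list. (cmod (coord vacuum w))\<^sup>2) has_sum 1) UNIV"
    by (rule has_sum_cong_neutral[THEN iffD1, rotated -1]) (auto simp: vacuum.rep_eq)
  then have "(norm (vacuum :: 'n fock))\<^sup>2 = 1" unfolding norm_fock_sq by (rule infsumI)
  then show ?thesis by (simp add: power2_eq_1_iff) (metis norm_ge_zero not_one_le_zero neg_0_le_iff_le)
qed

text \<open>On the vacuum all forms of positive degree vanish, so the Fejer bound with
  \<open>k = L = 1\<close> reduces to nonnegativity of the right-hand side.\<close>

lemma vacuum_coeff_le:
  fixes F :: "'n::finite fock \<Rightarrow>\<^sub>L 'n fock"
  assumes F: "\<And>x. (\<lambda>l. r ^ l *\<^sub>R blinfun_apply (hom_op c l) x) sums blinfun_apply F x"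
    and C: "norm F \<le> C"
  shows "cmod (c []) \<le> C"
proof -
  have v: "fock_scaleC b (hom_op c l vacuum) \<bullet> vacuum = 0" if "l > 0" for b l
    using that by (intro inner_fock_eq_0) (auto simp: fock_scaleC.rep_eq coord_hom_op vacuum.rep_eq)
  have "hom_op c 1 vacuum \<bullet> vacuum = 0"
    using v[of 1 1] fock_scaleC_of_real[of 1 "hom_op c 1 vacuum"] by simp
  then have "0 \<le> cos (pi / 3) * (C - cmod (c []))"
    using fejer_form_bound[OF F C, of 1 1 vacuum] v by (simp add: norm_vacuum mult.commute)
  then show ?thesis by (simp add: cos_60)
qed

lemma coord_hom_op_iterate:
  "length w \<noteq> j * k \<Longrightarrow> coord ((blinfun_apply (hom_op c k) ^^ j) vacuum) w = 0"
  by (induction j arbitrary: w) (auto simp: vacuum.rep_eq coord_hom_op)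

lemma norm_hom_op_iterate: "norm ((blinfun_apply (hom_op c k) ^^ j) vacuum) = hom_norm c k ^ j"
  by (induction j) (simp_all add: norm_hom_op norm_vacuum)

text \<open>Removes the factor n/(n + 1) lost by the finite test vectors.\<close>

lemma le_of_Suc_mult_le:
  fixes A B :: real
  assumes "\<And>n. A * real n \<le> B * real (Suc n)"
  shows "A \<le> B"
proof (rule ccontr)
  assume "\<not> A \<le> B"
  then obtain n where "B < real n * (A - B)" using reals_Archimedean3[of "A - B"] by auto
  with assms[of n] show False by (simp add: algebra_simps)
qed

text \<open>
  The homogeneous operator is a multiple of a pure isometry, so its numerical radius equals its
  norm; the vectors \<open>\<Sum>j\<le>n. (A / \<parallel>A\<parallel>)\<^sup>j 1\<close> attain it in the limit.
\<close>

lemma fejer_hom_norm_aux: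
  fixes F :: "'n::finite fock \<Rightarrow>\<^sub>L 'n fock"
  assumes F: "\<And>x. (\<lambda>l. r ^ l *\<^sub>R blinfun_apply (hom_op c l) x) sums blinfun_apply F x"
    and C: "norm F \<le> C" and k: "k > 0" and s: "hom_norm c k > 0"
    and L: "\<And>l \<alpha>. l > L \<Longrightarrow> l \<le> n * k \<Longrightarrow> length \<alpha> = l \<Longrightarrow> c \<alpha> = 0"
  shows "r ^ k * hom_norm c k * real n
    \<le> 2 * cos (pi / (real (L div k) + 2)) * (C - cmod (c [])) * real (Suc n)"
proof -
  define s where "s = hom_norm c k"
  define y where "y j = (1 / s ^ j) *\<^sub>R (blinfun_apply (hom_op c k) ^^ j) vacuum" for j
  define x where "x = (\<Sum>j\<le>n. y j)"
  have s0: "s > 0" using s by (simp add: s_def)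
  have y0: "coord (y j) w = 0" if "length w \<noteq> j * k" for j w
    using coord_hom_op_iterate[OF that] by (simp add: y_def coord_scaleR)
  have yy: "y i \<bullet> y j = (if i = j then 1 else 0)" for i j
  proof (cases "i = j")
    case True
    have "norm (y j) = 1" using s0 by (simp add: y_def norm_hom_op_iterate s_def[symmetric])
    then show ?thesis using True by (simp add: power2_norm_eq_inner[symmetric])
  next
    case False
    then have "i * k \<noteq> j * k" using k by simp
    then have "y i \<bullet> y j = 0" by (intro inner_fock_eq_0) (metis y0)
    then show ?thesis using False by simp
  qed
  have "hom_op c k (y j) = s *\<^sub>R y (Suc j)" for j
    using s0 by (simp add: y_def blinfun.scaleR_right)
  then have Ax: "hom_op c k x = (\<Sum>j\<le>n. s *\<^sub>R y (Suc j))"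
    by (simp add: x_def blinfun.sum_right)
  \<comment> \<open>The operator shifts the orthonormal vectors \<open>y j\<close> with factor
    \<open>s\<close>. The last one leaves the span, so \<open>n\<close> of the \<open>n + 1\<close>
    terms remain.\<close>
  have "(\<Sum>i\<le>n. \<Sum>j\<le>n. if Suc j = i then 1 else 0 :: real) = (\<Sum>j\<le>n. if j < n then 1 else 0)"
    by (subst sum.swap, intro sum.cong refl) (auto simp: Suc_le_eq)
  also have "\<dots> = (\<Sum>j<n. 1)"
    by (rule sum.mono_neutral_cong_right) auto
  finally have "(\<Sum>j\<le>n. s *\<^sub>R y (Suc j)) \<bullet> (\<Sum>i\<le>n. y i) = s * real n"
    by (simp add: inner_sum_left inner_sum_right yy sum_distrib_left[symmetric] del: sum.delta sum.delta')
  then have "hom_op c k x \<bullet> x = s * real n"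
    unfolding Ax by (simp only: x_def)
  moreover have "(norm x)\<^sup>2 = real (Suc n)"
    by (simp add: power2_norm_eq_inner x_def inner_sum_left inner_sum_right yy)
  \<comment> \<open>For \<open>l > n * k\<close> the form vanishes because \<open>x\<close> has no
    coordinates beyond degree \<open>n * k\<close>. Coefficients therefore need to vanish only up to
    that degree.\<close>
  moreover have "fock_scaleC b (hom_op c l x) \<bullet> x = 0" if l: "l > L" for l b
  proof (rule inner_fock_eq_0)
    fix w
    have x0: "coord x w = 0" if "length w > n * k"
      unfolding x_def coord_sum
    proof (intro sum.neutral ballI y0)
      fix j assume "j \<in> {..n}"
      then have "j * k \<le> n * k" by simp
      then show "length w \<noteq> j * k" using that by linarith
    qed
    show "coord (fock_scaleC b (hom_op c l x)) w = 0 \<or> coord x w = 0"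
    proof (cases "l \<le> n * k")
      case True
      then show ?thesis using L[OF l] by (auto simp: fock_scaleC.rep_eq coord_hom_op)
    next
      case False
      then show ?thesis using x0 by (auto simp: fock_scaleC.rep_eq coord_hom_op)
    qed
  qed
  ultimately show ?thesis
    using fejer_form_bound[OF F C k, of L x] by (simp add: s_def mult.assoc)
qed

lemma hom_norm_le_fejer:
  fixes F :: "'n::finite fock \<Rightarrow>\<^sub>L 'n fock"
  assumes F: "\<And>x. (\<lambda>l. r ^ l *\<^sub>R blinfun_apply (hom_op c l) x) sums blinfun_apply F x"
    and C: "norm F \<le> C" and k: "k > 0"
    and L: "\<And>\<alpha>. length \<alpha> > L \<Longrightarrow> c \<alpha> = 0"
  shows "r ^ k * hom_norm c k \<le> 2 * cos (pi / (real (L div k) + 2)) * (C - cmod (c []))"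
proof (cases "hom_norm c k > 0")
  case True
  show ?thesis
    by (rule le_of_Suc_mult_le, rule fejer_hom_norm_aux[OF F C k True]) (use L in auto)
next
  case False
  then have "hom_norm c k = 0" using hom_norm_nonneg[of c k] by simp
  moreover have "cos (pi / (real (L div k) + 2)) \<ge> 0"
    by (intro cos_ge_zero) (auto simp: field_simps)
  \<comment> \<open>Without a nonzero norm there are no normalized iterates, but then only the sign
    of the right-hand side matters.\<close>
  ultimately show ?thesis using vacuum_coeff_le[OF F C] by simp
qed

text \<open>With the cutoff \<open>L = n * k\<close> matched to the test vector, the vanishing
  condition is vacuous. Bounding the cosine by 1 leaves the constant 2.\<close>

lemma hom_norm_le_caratheodory:
  fixes F :: "'n::finite fock \<Rightarrow>\<^sub>L 'n fock"
  assumes F: "\<And>x. (\<lambda>l. r ^ l *\<^sub>R blinfun_apply (hom_op c l) x) sums blinfun_apply F x"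
    and C: "norm F \<le> C" and k: "k > 0"
  shows "r ^ k * hom_norm c k \<le> 2 * (C - cmod (c []))"
proof (cases "hom_norm c k > 0")
  case True
  have "r ^ k * hom_norm c k * real n \<le> 2 * (C - cmod (c [])) * real (Suc n)" for n
  proof -
    have "r ^ k * hom_norm c k * real n
      \<le> 2 * cos (pi / (real (n * k div k) + 2)) * (C - cmod (c [])) * real (Suc n)"
      by (rule fejer_hom_norm_aux[OF F C k True]) simp
    also have "\<dots> \<le> 2 * 1 * (C - cmod (c [])) * real (Suc n)"
      using vacuum_coeff_le[OF F C] by (intro mult_right_mono mult_left_mono) auto
    finally show ?thesis by simp
  qed
  then show ?thesis by (rule le_of_Suc_mult_le)
next
  case False
  then have "hom_norm c k = 0" using hom_norm_nonneg[of c k] by simp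
  then show ?thesis using vacuum_coeff_le[OF F C] by simp
qed

section \<open>The Bohr inequality\<close>

lemma finite_sums_imp_summable_infsum_le:
  fixes g :: "'a \<Rightarrow> real"
  assumes "\<And>x. x \<in> A \<Longrightarrow> g x \<ge> 0" "\<And>F. finite F \<Longrightarrow> F \<subseteq> A \<Longrightarrow> sum g F \<le> C"
  shows "g summable_on A \<and> infsum g A \<le> C"
proof
  show "g summable_on A"
    by (rule nonneg_bdd_above_summable_on) (use assms in \<open>auto intro!: bdd_aboveI\<close>)
  then show "infsum g A \<le> C" by (rule infsum_le_finite_sums) (use assms in auto)
qed

lemma le_of_power_mult_le:
  fixes s B :: real
  assumes "\<And>r. 0 \<le> r \<Longrightarrow> r < 1 \<Longrightarrow> r ^ k * s \<le> B"
  shows "s \<le> B"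
proof (rule tendsto_upperbound)
  show "((\<lambda>r. r ^ k * s) \<longlongrightarrow> s) (at_left 1)"
    by (auto intro!: tendsto_eq_intros)
  show "\<forall>\<^sub>F r in at_left 1. r ^ k * s \<le> B"
    using eventually_at_left_real[OF zero_less_one] by eventually_elim (use assms in auto)
qed simp

text \<open>The full series sums to exactly 1/2, so 1/3 solves the defining equation of the radius
  with every cosine replaced by 1.\<close>

lemma sum_third_powers_le: "(\<Sum>k=1..n. (1 / 3 :: real) ^ k) \<le> 1 / 2"
proof -
  have "(\<Sum>k=1..n. (1 / 3 :: real) ^ k) = (1 - (1 / 3) ^ n) / 2"
  proof (induction n)
    case (Suc n)
    have "(\<Sum>k=1..Suc n. (1 / 3 :: real) ^ k) = (\<Sum>k=1..n. (1 / 3) ^ k) + (1 / 3) ^ Suc n" by simp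
    also have "\<dots> = (1 - (1 / 3) ^ Suc n) / 2" unfolding Suc.IH by (simp add: field_simps)
    finally show ?case .
  qed simp
  then show ?thesis by simp
qed

theorem corollary4p4:
  fixes m :: enat
    and f :: "complex ^ 'n \<Rightarrow> complex"
    and a :: "('n \<Rightarrow> nat) \<Rightarrow> complex"
    and z :: "complex ^ 'n"
  assumes "m \<ge> 2"
    and "\<forall>w\<in>ball 0 1. ((\<lambda>p. mi_power w p * a p) has_sum f w) {p. enat (mi_deg p) \<le> m - 1}"
    and "f \<in> Hinf_sym"
    and "z \<in> ball 0 1"
    and "norm z \<le> bohr_radius m"
  shows "(\<lambda>k. cmod (\<Sum>p | mi_deg p = k. mi_power z p * of_real (cmod (a p))))
             summable_on {k. enat k \<le> m - 1} \<and>
         (\<Sum>\<^sub>\<infinity>k | enat k \<le> m - 1. cmod (\<Sum>p | mi_deg p = k. mi_power z p * of_real (cmod (a p))))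
             \<le> norm_sym f"
proof -
  \<comment> \<open>The hypothesis does not constrain \<open>a\<close> outside the degree range, so
    the Taylor coefficients of \<open>f\<close> are its extension by zero.\<close>
  define b where "b p = (if enat (mi_deg p) \<le> m - 1 then a p else 0)" for p
  define c where "c = sym_coeff b"
  define C where "C = norm_sym f"
  define g where "g k = cmod (\<Sum>p | mi_deg p = k. mi_power z p * of_real (cmod (a p)))" for k
  have "ball_series f b"
    unfolding ball_series_def
  proof
    fix w :: "complex ^ 'n" assume "w \<in> ball 0 1"
    then have "((\<lambda>p. mi_power w p * a p) has_sum f w) {p. enat (mi_deg p) \<le> m - 1}"
      using assms(2) by blast
    then show "((\<lambda>p. mi_power w p * b p) has_sum f w) UNIV"
      by (rule has_sum_cong_neutral[THEN iffD1, rotated -1]) (auto simp: b_def)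
  qed
  moreover from assms(3) obtain b' where "ball_series f b'"
    and lim': "limsup (\<lambda>k. ereal (root (2 * k)
       (\<Sum>p | mi_deg p = k. fact (mi_deg p) / real (mi_fact p) * (cmod (b' p))\<^sup>2))) \<le> 1"
    and bdd': "bdd_above ((\<lambda>r. norm (sym_op b' r)) ` {0..<1})"
    unfolding Hinf_sym_def by blast
  ultimately have "b' = b" "ball_coeffs f = b"
    by (auto intro: ball_series_unique ball_coeffs_eq)
  note lim = lim'[unfolded \<open>b' = b\<close>] and bdd = bdd'[unfolded \<open>b' = b\<close>]
  have C: "norm (sym_op b r) \<le> C" if "0 \<le> r" "r < 1" for r
    unfolding C_def norm_sym_def \<open>ball_coeffs f = b\<close>
    by (rule cSUP_upper[OF _ bdd]) (use that in simp)
  note F = sym_op_sums[OF lim, folded c_def]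
  have c0: "cmod (c []) \<le> C"
    by (rule vacuum_coeff_le[of 0 c "sym_op b 0", OF F C]) auto
  have g: "g k \<le> norm z ^ k * hom_norm c k" if "enat k \<le> m - 1" for k
  proof -
    have "g k = cmod (\<Sum>p | mi_deg p = k. mi_power z p * of_real (cmod (b p)))"
      unfolding g_def using that by (intro arg_cong[of _ _ cmod] sum.cong refl) (auto simp: b_def)
    then show ?thesis using homogeneous_part_le[of z b k] by (simp add: c_def)
  qed
  \<comment> \<open>\<open>v\<close> collects the radius power and, for finite \<open>m\<close>, the
    cosine. The choice of radius is precisely what makes its sums over positive degrees at most
    1/2.\<close>
  obtain v where v: "\<And>k. k > 0 \<Longrightarrow> enat k \<le> m - 1 \<Longrightarrow> g k \<le> v k * (2 * (C - cmod (c [])))"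
    and v_sum: "\<And>I. finite I \<Longrightarrow> I \<subseteq> {k. enat k \<le> m - 1} - {0} \<Longrightarrow> sum v I \<le> 1 / 2"
  proof (cases m)
    case (enat N)
    define q where "q k = cos (pi / (real ((N - 1) div k) + 2))" for k
    have q: "q k \<ge> 0" for k
      unfolding q_def by (intro cos_ge_zero) (auto simp: field_simps)
    have N: "N \<ge> 2" using assms(1) enat by (simp add: numeral_eq_enat)
    have le_iff: "enat k \<le> m - 1 \<longleftrightarrow> k \<le> N - 1" for k
      by (simp add: enat one_enat_def)
    define t where "t = bohr_radius m"
    have "0 < t \<and> t \<le> 1 \<and> bohr_sum N t = 1 / 2"
      unfolding t_def bohr_radius_def enat enat.case by (rule theI'[OF bohr_sum_unique_solution[OF N]])
    then have t: "t > 0" "bohr_sum N t = 1 / 2" by auto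
    show ?thesis
    proof (rule that[of "\<lambda>k. t ^ k * q k"])
      fix k assume k: "k > 0" "enat k \<le> m - 1"
      \<comment> \<open>The polynomial has degree at most \<open>N - 1\<close>, which is the cutoff
        in the Fejer bound.\<close>
      have c: "c \<alpha> = 0" if "length \<alpha> > N - 1" for \<alpha>
        using that by (simp add: c_def sym_coeff_def b_def mi_deg_count_list le_iff)
      have "hom_norm c k \<le> 2 * q k * (C - cmod (c []))"
      proof (rule le_of_power_mult_le)
        fix r :: real assume r: "0 \<le> r" "r < 1"
        show "r ^ k * hom_norm c k \<le> 2 * q k * (C - cmod (c []))"
          unfolding q_def by (rule hom_norm_le_fejer[OF F[OF r] C[OF r] k(1) c])
      qed
      then have "norm z ^ k * hom_norm c k \<le> t ^ k * (2 * q k * (C - cmod (c [])))"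
        using t assms(5) by (intro mult_mono power_mono) (auto simp: t_def hom_norm_nonneg)
      then show "g k \<le> t ^ k * q k * (2 * (C - cmod (c [])))"
        using g[OF k(2)] by (simp add: mult_ac)
    next
      fix I :: "nat set" assume "finite I" "I \<subseteq> {k. enat k \<le> m - 1} - {0}"
      then have "I \<subseteq> {1..N - 1}" by (auto simp: le_iff Suc_le_eq)
      then have "(\<Sum>k\<in>I. t ^ k * q k) \<le> (\<Sum>k=1..N - 1. t ^ k * q k)"
        using t q by (intro sum_mono2) auto
      also have "\<dots> = 1 / 2" using t(2) by (simp add: bohr_sum_def q_def)
      finally show "(\<Sum>k\<in>I. t ^ k * q k) \<le> 1 / 2" .
    qed
  next
    case infinity
    have z: "norm z \<le> 1 / 3" using assms(5) infinity by (simp add: bohr_radius_def)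
    show ?thesis
    proof (rule that[of "\<lambda>k. (1 / 3) ^ k"])
      fix k assume k: "k > 0" "enat k \<le> m - 1"
      have "hom_norm c k \<le> 2 * (C - cmod (c []))"
      proof (rule le_of_power_mult_le)
        fix r :: real assume r: "0 \<le> r" "r < 1"
        show "r ^ k * hom_norm c k \<le> 2 * (C - cmod (c []))"
          by (rule hom_norm_le_caratheodory[OF F[OF r] C[OF r] k(1)])
      qed
      then have "norm z ^ k * hom_norm c k \<le> (1 / 3) ^ k * (2 * (C - cmod (c [])))"
        using z by (intro mult_mono power_mono) (auto simp: hom_norm_nonneg)
      then show "g k \<le> (1 / 3) ^ k * (2 * (C - cmod (c [])))"
        using g[OF k(2)] by linarith
    next
      fix I :: "nat set" assume I: "finite I" "I \<subseteq> {k. enat k \<le> m - 1} - {0}"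
      then have "I \<subseteq> {1..Max (insert 0 I)}" by (auto simp: Suc_le_eq)
      then have "(\<Sum>k\<in>I. (1 / 3 :: real) ^ k) \<le> (\<Sum>k=1..Max (insert 0 I). (1 / 3) ^ k)"
        by (intro sum_mono2) auto
      then show "(\<Sum>k\<in>I. (1 / 3 :: real) ^ k) \<le> 1 / 2"
        using sum_third_powers_le[of "Max (insert 0 I)"] by linarith
    qed
  qed
  have "sum g I \<le> C" if I: "finite I" "I \<subseteq> {k. enat k \<le> m - 1}" for I
  proof -
    have "enat 0 \<le> m - 1" by (simp add: zero_enat_def[symmetric])
    then have g0: "g 0 \<le> cmod (c [])" using g[of 0] by (simp add: hom_norm_def)
    \<comment> \<open>Degree 0 is added and split off: it contributes at most
      \<open>cmod (c [])\<close>, and the remaining degrees at most the gap to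
      \<open>C\<close>.\<close>
    have "sum g I \<le> sum g (insert 0 I)"
      using I by (intro sum_mono2) (auto simp: g_def)
    also have "\<dots> = g 0 + sum g (I - {0})"
      using I by (simp add: sum.insert_remove)
    also have "\<dots> \<le> cmod (c []) + (\<Sum>k\<in>I - {0}. v k * (2 * (C - cmod (c []))))"
      using I by (intro add_mono g0 sum_mono v) auto
    also have "\<dots> = cmod (c []) + sum v (I - {0}) * (2 * (C - cmod (c [])))"
      by (simp add: sum_distrib_right)
    also have "\<dots> \<le> cmod (c []) + 1 / 2 * (2 * (C - cmod (c [])))"
      using I c0 by (intro add_left_mono mult_right_mono v_sum) auto
    finally show ?thesis by (simp add: field_simps)
  qed
  then show ?thesis
    unfolding C_def[symmetric] g_def[symmetric]
    by (intro finite_sums_imp_summable_infsum_le) (auto simp: g_def)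
qed

end
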